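(* Let $\Theta_1,\Theta_2$ be $n\times p$ matrices and $\beta$ an $n\times n$ matrix such that $$\beta^*-\beta=i\big(\Theta_2-\Theta_1\big)D^{-1}\big(\Theta_2-\Theta_1\big)^*,$$ where $D=\mathrm{diag}\{d_1,\dots,d_p\}$, $d_1\ge d_2\ge\dots\ge d_p>0$. Let $0<l<\infty$ and let $S$ be the operator on $L^2_p(0,l)$ given by $$(Sf)(x)=f(x)+\int_0^l k(x,t)f(t)\,dt,\qquad k(x,t)=\{k_{ij}(d_ix-d_jt)\}_{i,j=1}^p,$$ where $k_{ij}(\cdot)$ are the entries of the $p\times p$ matrix function $$k(x)=\Theta_2^*e^{ix\beta^*}\Theta_1\quad(0<x<d_1l),\qquad k(-x)=k(x)^*.$$ Then $S$ is positive and boundedly invertible.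
   Context: $p,n$ are positive integers and all matrices are complex. $L^2_p(0,l)$ is the Hilbert space of $\mathbb C^p$-valued square integrable functions on $(0,l)$. "Positive" means $(Sf,f)_{L^2}>0$ for every $f\neq0$ in $L^2_p(0,l)$; "boundedly invertible" means that $S$ has a bounded inverse on $L^2_p(0,l)$. *)

theory Defs
  imports "HOL-Analysis.Analysis"
begin

text \<open>
  A complex \<open>n \<times> p\<close> matrix is an element of \<open>complex^'p^'n\<close>. The product of matrices is \<open>**\<close>:
  the operations \<open>*\<close>, \<open>^\<close> and \<open>1\<close> of the type \<open>vec\<close> are componentwise and are not used here.
\<close>

definition conj_transpose :: "complex^'m^'n \<Rightarrow> complex^'n^'m" where
  "conj_transpose A = map_matrix cnj (transpose A)"

definition cscale :: "complex \<Rightarrow> complex^'m^'n \<Rightarrow> complex^'m^'n" where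
  "cscale c A = map_matrix (\<lambda>z. c * z) A"

definition diag_matrix :: "('n::finite \<Rightarrow> real) \<Rightarrow> complex^'n^'n" where
  "diag_matrix d = (\<chi> i j. if i = j then complex_of_real (d i) else 0)"

definition matrix_power :: "complex^'n^'n \<Rightarrow> nat \<Rightarrow> complex^'n^'n" where
  "matrix_power A m = (((**) A) ^^ m) (mat 1)"

text \<open>The series converges absolutely for every \<open>A\<close>, so \<open>suminf\<close> is its genuine sum.\<close>

definition matrix_exp :: "complex^'n^'n \<Rightarrow> complex^'n^'n" where
  "matrix_exp A = (\<Sum>m. (1 / fact m :: real) *\<^sub>R matrix_power A m)"

text \<open>
  Elements of the space are represented by functions, two functions representing the same
  element iff they agree almost everywhere on \<open>(0,l)\<close>; their values outside \<open>(0,l)\<close> are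
  irrelevant. The norm on \<open>complex^'p\<close> is the Euclidean one.
\<close>

abbreviation leb_on :: "real \<Rightarrow> real measure" where
  "leb_on l \<equiv> lebesgue_on {0<..<l}"

definition L2 :: "real \<Rightarrow> (real \<Rightarrow> complex^'p) set" where
  "L2 l = {f. f \<in> borel_measurable (leb_on l) \<and> integrable (leb_on l) (\<lambda>x. (norm (f x))\<^sup>2)}"

definition L2_eq :: "real \<Rightarrow> (real \<Rightarrow> complex^'p) \<Rightarrow> (real \<Rightarrow> complex^'p) \<Rightarrow> bool" where
  "L2_eq l f g \<longleftrightarrow> (AE x in leb_on l. f x = g x)"

definition L2_inner :: "real \<Rightarrow> (real \<Rightarrow> complex^'p) \<Rightarrow> (real \<Rightarrow> complex^'p) \<Rightarrow> complex" where
  "L2_inner l f g = (LINT x|leb_on l. (\<Sum>i\<in>UNIV. f x $ i * cnj (g x $ i)))"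

definition L2_norm :: "real \<Rightarrow> (real \<Rightarrow> complex^'p) \<Rightarrow> real" where
  "L2_norm l f = sqrt (LINT x|leb_on l. (norm (f x))\<^sup>2)"

text \<open>Everywhere defined bounded complex-linear operators, well-defined on equivalence classes.\<close>

definition bounded_operator_L2 ::
  "real \<Rightarrow> ((real \<Rightarrow> complex^'p) \<Rightarrow> (real \<Rightarrow> complex^'p)) \<Rightarrow> bool" where
  "bounded_operator_L2 l T \<longleftrightarrow>
     (\<forall>f\<in>L2 l. T f \<in> L2 l) \<and>
     (\<forall>f\<in>L2 l. \<forall>g\<in>L2 l. L2_eq l f g \<longrightarrow> L2_eq l (T f) (T g)) \<and>
     (\<forall>f\<in>L2 l. \<forall>g\<in>L2 l. L2_eq l (T (\<lambda>x. f x + g x)) (\<lambda>x. T f x + T g x)) \<and>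
     (\<forall>c. \<forall>f\<in>L2 l. L2_eq l (T (\<lambda>x. c *s f x)) (\<lambda>x. c *s T f x)) \<and>
     (\<exists>C. \<forall>f\<in>L2 l. L2_norm l (T f) \<le> C * L2_norm l f)"

definition positive_operator_L2 ::
  "real \<Rightarrow> ((real \<Rightarrow> complex^'p) \<Rightarrow> (real \<Rightarrow> complex^'p)) \<Rightarrow> bool" where
  "positive_operator_L2 l T \<longleftrightarrow>
     (\<forall>f\<in>L2 l. \<not> L2_eq l f (\<lambda>x. 0) \<longrightarrow>
        L2_inner l (T f) f \<in> \<real> \<and> Re (L2_inner l (T f) f) > 0)"

definition boundedly_invertible_L2 ::
  "real \<Rightarrow> ((real \<Rightarrow> complex^'p) \<Rightarrow> (real \<Rightarrow> complex^'p)) \<Rightarrow> bool" where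
  "boundedly_invertible_L2 l T \<longleftrightarrow>
     (\<exists>R. bounded_operator_L2 l R \<and>
        (\<forall>f\<in>L2 l. L2_eq l (T (R f)) f \<and> L2_eq l (R (T f)) f))"

definition D_difference_kernel ::
  "('p::finite \<Rightarrow> real) \<Rightarrow> (real \<Rightarrow> complex^'p^'p) \<Rightarrow> real \<Rightarrow> real \<Rightarrow> complex^'p^'p" where
  "D_difference_kernel d k x t = (\<chi> i j. k (d i * x - d j * t) $ i $ j)"

definition S_operator ::
  "real \<Rightarrow> ('p::finite \<Rightarrow> real) \<Rightarrow> (real \<Rightarrow> complex^'p^'p) \<Rightarrow>
     (real \<Rightarrow> complex^'p) \<Rightarrow> (real \<Rightarrow> complex^'p)" where
  "S_operator l d k f = (\<lambda>x. f x + (LINT t|leb_on l. D_difference_kernel d k x t *v f t))"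

end

theory Submission
  imports Defs
begin

text \<open>
  Why \<open>S\<close> is positive. Put \<open>\<Delta> = \<Theta>\<^sub>2 - \<Theta>\<^sub>1\<close> and \<open>L = d\<^sub>1 l\<close>, and regard a function \<open>f\<close> as a control: its
  component \<open>f\<^sub>j(t)\<close> acts at time \<open>d\<^sub>j t\<close> on a linear system with the state

    \<open>U(z) = \<Sum>j. \<integral> exp (i (z - d\<^sub>j t) \<beta>\<^sup>*) \<Theta>\<^sub>1 e\<^sub>j f\<^sub>j(t) dt\<close>, the integral being over \<open>d\<^sub>j t < z\<close>.

  The hypothesis on \<open>\<beta>\<close> says that a freely moving state loses energy at the rate
  \<open>\<Sum>q. \<bar>(\<Delta>\<^sup>*U)\<^sub>q\<bar>\<^sup>2 / d\<^sub>q\<close>. Let \<open>V\<close> be the Volterra operator \<open>(Vf)\<^sub>i(s) = (\<Delta>\<^sup>*U(d\<^sub>i s))\<^sub>i\<close>. The energy balance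
  between the control, the dissipation and the final state is an identity of kernels
  (\<open>energy_balance\<close>), and it gives the identity of forms (\<open>damped_form_identity\<close>)

    \<open>(Sf,f) = \<parallel>f\<parallel>\<^sup>2 + 2 Re (Vf,f) + \<Sum>q. \<integral> \<bar>(\<Delta>\<^sup>*U(z))\<^sub>q\<bar>\<^sup>2 / d\<^sub>q dz + \<parallel>U(L)\<parallel>\<^sup>2\<close>,

  with \<open>z\<close> running over \<open>(0,L)\<close>. Restricting the \<open>q\<close>-th integral to \<open>(0, d\<^sub>q l)\<close> and substituting
  \<open>z = d\<^sub>q s\<close> bounds the sum of the integrals from below by \<open>\<parallel>Vf\<parallel>\<^sup>2\<close>, so that
  \<open>(Sf,f) \<ge> \<parallel>f + Vf\<parallel>\<^sup>2\<close> (\<open>damped_form_ge_volterra\<close>). As \<open>V\<close> is a Volterra operator in the time variable,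
  \<open>1 + V\<close> is bounded below (\<open>volterra_lower_bound\<close>), and \<open>(Sf,f) \<ge> c \<parallel>f\<parallel>\<^sup>2\<close> follows with some \<open>c > 0\<close>.
  In particular \<open>S\<close> is positive.

  Why \<open>S\<close> is boundedly invertible. Every coercive operator \<open>1 + K\<close> with a bounded kernel is
  (\<open>boundedly_invertible_S\<close>): \<open>1 - \<tau>S\<close> is a contraction for small \<open>\<tau> > 0\<close>, and the Neumann series of
  \<open>\<tau>S\<close> about the identity solves \<open>Sh = f\<close>. Because \<open>K\<close> maps \<open>L\<^sup>2\<close> into bounded functions, this series
  converges at every point with an integrable majorant, and dominated convergence allows \<open>K\<close> to be
  applied term by term.
\<close>

section \<open>Bounded kernels and their forms\<close>

text \<open>
  All kernels of the proof are bounded and jointly measurable on a product of two intervals, and all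
  functions that they act on are integrable, so that Fubini's theorem applies throughout.
\<close>

definition bounded_kernel :: "'a measure \<Rightarrow> 'b measure \<Rightarrow> ('a \<Rightarrow> 'b \<Rightarrow> complex) \<Rightarrow> bool" where
  "bounded_kernel N M H \<longleftrightarrow> case_prod H \<in> borel_measurable (N \<Otimes>\<^sub>M M) \<and>
     (\<exists>B. \<forall>z\<in>space N. \<forall>t\<in>space M. norm (H z t) \<le> B)"

lemma bounded_kernelI:
  assumes "case_prod H \<in> borel_measurable (N \<Otimes>\<^sub>M M)"
    and "\<And>z t. z \<in> space N \<Longrightarrow> t \<in> space M \<Longrightarrow> norm (H z t) \<le> B"
  shows "bounded_kernel N M H"
  using assms unfolding bounded_kernel_def by blast

lemma bounded_kernel_measurable [measurable_dest]:
  "bounded_kernel N M H \<Longrightarrow> case_prod H \<in> borel_measurable (N \<Otimes>\<^sub>M M)"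
  by (simp add: bounded_kernel_def)

lemma bounded_kernel_bound:
  assumes "bounded_kernel N M H"
  obtains B where "B \<ge> 0" "\<And>z t. z \<in> space N \<Longrightarrow> t \<in> space M \<Longrightarrow> norm (H z t) \<le> B"
proof -
  obtain B where "\<forall>z\<in>space N. \<forall>t\<in>space M. norm (H z t) \<le> B"
    using assms unfolding bounded_kernel_def by blast
  then show ?thesis
    by (intro that[of "max B 0"]) (auto simp: le_max_iff_disj)
qed

lemma bounded_kernel_cong:
  assumes "bounded_kernel N M H" "\<And>z t. z \<in> space N \<Longrightarrow> t \<in> space M \<Longrightarrow> H' z t = H z t"
  shows "bounded_kernel N M H'"
proof -
  have "case_prod H' \<in> borel_measurable (N \<Otimes>\<^sub>M M) \<longleftrightarrow> case_prod H \<in> borel_measurable (N \<Otimes>\<^sub>M M)"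
    by (rule measurable_cong) (auto simp: space_pair_measure assms(2))
  then show ?thesis
    using assms unfolding bounded_kernel_def by auto
qed

lemma bounded_kernel_add:
  assumes "bounded_kernel N M G" "bounded_kernel N M H"
  shows "bounded_kernel N M (\<lambda>z t. G z t + H z t)"
proof -
  note [measurable] = assms[THEN bounded_kernel_measurable]
  obtain A where A: "\<And>z t. z \<in> space N \<Longrightarrow> t \<in> space M \<Longrightarrow> norm (G z t) \<le> A"
    using bounded_kernel_bound[OF assms(1)] by metis
  obtain B where B: "\<And>z t. z \<in> space N \<Longrightarrow> t \<in> space M \<Longrightarrow> norm (H z t) \<le> B"
    using bounded_kernel_bound[OF assms(2)] by metis
  show ?thesis
    by (rule bounded_kernelI[where B="A + B"]) (measurable, intro norm_triangle_mono A B)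
qed

lemma bounded_kernel_mult:
  assumes "bounded_kernel N M G" "bounded_kernel N M H"
  shows "bounded_kernel N M (\<lambda>z t. G z t * H z t)"
proof -
  note [measurable] = assms[THEN bounded_kernel_measurable]
  obtain A where A: "A \<ge> 0" "\<And>z t. z \<in> space N \<Longrightarrow> t \<in> space M \<Longrightarrow> norm (G z t) \<le> A"
    using bounded_kernel_bound[OF assms(1)] by metis
  obtain B where B: "\<And>z t. z \<in> space N \<Longrightarrow> t \<in> space M \<Longrightarrow> norm (H z t) \<le> B"
    using bounded_kernel_bound[OF assms(2)] by metis
  show ?thesis
    by (rule bounded_kernelI[where B="A * B"])
      (measurable, auto simp: norm_mult intro!: mult_mono A B)
qed

lemma bounded_kernel_const: "bounded_kernel N M (\<lambda>z t. c)"
  by (rule bounded_kernelI[where B="norm c"]) auto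

lemma bounded_kernel_sum:
  "(\<And>i. i \<in> I \<Longrightarrow> bounded_kernel N M (H i)) \<Longrightarrow> bounded_kernel N M (\<lambda>z t. \<Sum>i\<in>I. H i z t)"
  by (induction I rule: infinite_finite_induct)
    (auto intro: bounded_kernel_const bounded_kernel_add)

lemma bounded_kernel_cnj:
  assumes "bounded_kernel N M H"
  shows "bounded_kernel N M (\<lambda>z t. cnj (H z t))"
proof -
  note [measurable] = assms[THEN bounded_kernel_measurable]
  have [measurable]: "cnj \<in> borel_measurable borel"
    by (intro borel_measurable_continuous_onI continuous_intros)
  show ?thesis
    using assms unfolding bounded_kernel_def by auto
qed

lemma bounded_kernel_transpose:
  assumes "bounded_kernel N M H"
  shows "bounded_kernel M N (\<lambda>z t. H t z)"
proof -
  note [measurable] = assms[THEN bounded_kernel_measurable]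
  show ?thesis
    using assms unfolding bounded_kernel_def by auto
qed

lemma bounded_kernel_left:
  assumes "h \<in> borel_measurable N" "\<And>z. z \<in> space N \<Longrightarrow> norm (h z) \<le> B"
  shows "bounded_kernel N M (\<lambda>z t. h z)"
  using assms by (intro bounded_kernelI[where B=B]) auto

lemma bounded_kernel_section:
  assumes "bounded_kernel N M H" "z \<in> space N"
  shows "H z \<in> borel_measurable M"
  using measurable_Pair2[OF bounded_kernel_measurable[OF assms(1)] assms(2)] by simp

lemma integrable_bounded_kernel_section:
  assumes H: "bounded_kernel N M H" and z: "z \<in> space N" and \<phi>: "integrable M \<phi>"
  shows "integrable M (\<lambda>t. H z t * \<phi> t)"
proof -
  obtain B where B: "\<And>z t. z \<in> space N \<Longrightarrow> t \<in> space M \<Longrightarrow> norm (H z t) \<le> B"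
    using bounded_kernel_bound[OF H] by metis
  note [measurable] = bounded_kernel_section[OF H z] borel_measurable_integrable[OF \<phi>]
  show ?thesis
  proof (rule Bochner_Integration.integrable_bound)
    show "integrable M (\<lambda>t. B * norm (\<phi> t))" using \<phi> by auto
    show "AE t in M. norm (H z t * \<phi> t) \<le> norm (B * norm (\<phi> t))"
      using B[OF z] by (intro AE_I2) (smt (verit) mult_right_mono norm_ge_zero norm_mult real_norm_def)
  qed measurable
qed

lemma kernel_integral_bound:
  fixes h \<phi> :: "'a \<Rightarrow> complex"
  assumes B: "\<And>t. t \<in> space M \<Longrightarrow> norm (h t) \<le> B" and i: "integrable M (\<lambda>t. h t * \<phi> t)"
    and \<phi>: "integrable M \<phi>"
  shows "norm (LINT t|M. h t * \<phi> t) \<le> B * (LINT t|M. norm (\<phi> t))"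
proof -
  have "norm (LINT t|M. h t * \<phi> t) \<le> (LINT t|M. norm (h t * \<phi> t))"
    by simp
  also have "\<dots> \<le> (LINT t|M. B * norm (\<phi> t))"
    using integrable_norm[OF i] \<phi> by (intro integral_mono) (auto simp: norm_mult intro!: mult_right_mono B)
  finally show ?thesis by simp
qed

lemma bounded_kernel_integral:
  assumes "sigma_finite_measure M" and H: "bounded_kernel N M H" and \<phi>: "integrable M \<phi>"
  shows "(\<lambda>z. LINT t|M. H z t * \<phi> t) \<in> borel_measurable N"
    and "\<exists>C. \<forall>z\<in>space N. norm (LINT t|M. H z t * \<phi> t) \<le> C"
proof -
  interpret sigma_finite_measure M by fact
  note [measurable] = bounded_kernel_measurable[OF H] borel_measurable_integrable[OF \<phi>]
  show "(\<lambda>z. LINT t|M. H z t * \<phi> t) \<in> borel_measurable N"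
    by measurable
  obtain B where B: "\<And>z t. z \<in> space N \<Longrightarrow> t \<in> space M \<Longrightarrow> norm (H z t) \<le> B"
    using bounded_kernel_bound[OF H] by metis
  show "\<exists>C. \<forall>z\<in>space N. norm (LINT t|M. H z t * \<phi> t) \<le> C"
  proof (intro exI ballI)
    fix z assume z: "z \<in> space N"
    show "norm (LINT t|M. H z t * \<phi> t) \<le> B * (LINT t|M. norm (\<phi> t))"
      by (rule kernel_integral_bound[OF B[OF z] integrable_bounded_kernel_section[OF H z \<phi>] \<phi>])
  qed
qed

text \<open>
  The integrand is dominated by a constant times \<open>norm (\<phi> t) * norm (\<psi> z)\<close>, which is integrable on
  the product.
\<close>

lemma bounded_kernel_Fubini:
  assumes N: "sigma_finite_measure N" and M: "sigma_finite_measure M"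
    and H: "bounded_kernel N M H" and \<phi>: "integrable M \<phi>" and \<psi>: "integrable N \<psi>"
  shows "(LINT z|N. (LINT t|M. H z t * \<phi> t) * \<psi> z) = (LINT t|M. (LINT z|N. H z t * \<psi> z) * \<phi> t)"
proof -
  interpret N: sigma_finite_measure N by fact
  interpret M: sigma_finite_measure M by fact
  interpret P: pair_sigma_finite N M ..
  note [measurable] = bounded_kernel_measurable[OF H] borel_measurable_integrable[OF \<phi>]
    borel_measurable_integrable[OF \<psi>]
  obtain B where B: "B \<ge> 0" "\<And>z t. z \<in> space N \<Longrightarrow> t \<in> space M \<Longrightarrow> norm (H z t) \<le> B"
    using bounded_kernel_bound[OF H] by metis
  have sec: "integrable M (\<lambda>t. H z t * \<phi> t)" if "z \<in> space N" for z
    by (rule integrable_bounded_kernel_section[OF H that \<phi>])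
  have "integrable (N \<Otimes>\<^sub>M M) (\<lambda>(z, t). H z t * \<phi> t * \<psi> z)"
  proof (rule P.Fubini_integrable)
    show "(\<lambda>(z, t). H z t * \<phi> t * \<psi> z) \<in> borel_measurable (N \<Otimes>\<^sub>M M)" by measurable
    show "AE z in N. integrable M (\<lambda>t. case (z, t) of (z, t) \<Rightarrow> H z t * \<phi> t * \<psi> z)"
      using sec by (intro AE_I2) auto
    show "integrable N (\<lambda>z. LINT t|M. norm (case (z, t) of (z, t) \<Rightarrow> H z t * \<phi> t * \<psi> z))"
    proof (rule Bochner_Integration.integrable_bound)
      show "integrable N (\<lambda>z. B * (LINT t|M. norm (\<phi> t)) * norm (\<psi> z))"
        using \<psi> by simp
      show "AE z in N. norm (LINT t|M. norm (case (z, t) of (z, t) \<Rightarrow> H z t * \<phi> t * \<psi> z))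
          \<le> norm (B * (LINT t|M. norm (\<phi> t)) * norm (\<psi> z))"
      proof (intro AE_I2)
        fix z assume z: "z \<in> space N"
        have "(LINT t|M. norm (H z t * \<phi> t)) \<le> (LINT t|M. B * norm (\<phi> t))"
          using integrable_norm[OF sec[OF z]] \<phi> B z
          by (intro integral_mono) (auto simp: norm_mult intro!: mult_right_mono)
        then have "(LINT t|M. norm (H z t * \<phi> t)) * norm (\<psi> z)
            \<le> B * (LINT t|M. norm (\<phi> t)) * norm (\<psi> z)"
          by (intro mult_right_mono) auto
        then show "norm (LINT t|M. norm (case (z, t) of (z, t) \<Rightarrow> H z t * \<phi> t * \<psi> z))
          \<le> norm (B * (LINT t|M. norm (\<phi> t)) * norm (\<psi> z))"
          using B(1) by (simp add: norm_mult)
      qed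
    qed measurable
  qed
  then have "(LINT t|M. LINT z|N. H z t * \<phi> t * \<psi> z) = (LINT z|N. LINT t|M. H z t * \<phi> t * \<psi> z)"
    by (rule P.Fubini_integral)
  moreover have "(LINT z|N. H z t * \<phi> t * \<psi> z) = (LINT z|N. H z t * \<psi> z) * \<phi> t" for t
    by (subst integral_mult_left_zero[symmetric]) (simp add: mult_ac)
  ultimately show ?thesis by simp
qed

text \<open>
  The sesquilinear form \<open>(H\<phi>, \<psi>)\<close> of the integral operator with kernel \<open>H\<close>.
\<close>

definition kernel_form ::
  "'a measure \<Rightarrow> ('a \<Rightarrow> 'a \<Rightarrow> complex) \<Rightarrow> ('a \<Rightarrow> complex) \<Rightarrow> ('a \<Rightarrow> complex) \<Rightarrow> complex" where
  "kernel_form M H \<phi> \<psi> = (LINT s|M. (LINT t|M. H s t * \<phi> t) * cnj (\<psi> s))"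

lemma integrable_kernel_form:
  assumes M: "sigma_finite_measure M" and H: "bounded_kernel M M H"
    and \<phi>: "integrable M \<phi>" and \<psi>: "integrable M \<psi>"
  shows "integrable M (\<lambda>s. (LINT t|M. H s t * \<phi> t) * cnj (\<psi> s))"
proof -
  obtain C where C: "\<forall>z\<in>space M. norm (LINT t|M. H z t * \<phi> t) \<le> C"
    using bounded_kernel_integral(2)[OF M H \<phi>] by blast
  show ?thesis
  proof (rule Bochner_Integration.integrable_bound)
    show "integrable M (\<lambda>s. C * norm (\<psi> s))" using \<psi> by simp
    have [measurable]: "cnj \<in> borel_measurable borel"
      by (intro borel_measurable_continuous_onI continuous_intros)
    note [measurable] = bounded_kernel_integral(1)[OF M H \<phi>] borel_measurable_integrable[OF \<psi>]
    show "(\<lambda>s. (LINT t|M. H s t * \<phi> t) * cnj (\<psi> s)) \<in> borel_measurable M" by measurable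
    show "AE s in M. norm ((LINT t|M. H s t * \<phi> t) * cnj (\<psi> s)) \<le> norm (C * norm (\<psi> s))"
    proof (intro AE_I2)
      fix s assume "s \<in> space M"
      then have "norm (LINT t|M. H s t * \<phi> t) * norm (\<psi> s) \<le> \<bar>C\<bar> * norm (\<psi> s)"
        using C by (intro mult_right_mono) fastforce+
      then show "norm ((LINT t|M. H s t * \<phi> t) * cnj (\<psi> s)) \<le> norm (C * norm (\<psi> s))"
        by (simp add: norm_mult abs_mult)
    qed
  qed
qed

lemma kernel_form_add:
  assumes M: "sigma_finite_measure M" and G: "bounded_kernel M M G" and H: "bounded_kernel M M H"
    and \<phi>: "integrable M \<phi>" and \<psi>: "integrable M \<psi>"
  shows "kernel_form M (\<lambda>s t. G s t + H s t) \<phi> \<psi> = kernel_form M G \<phi> \<psi> + kernel_form M H \<phi> \<psi>"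
proof -
  have "kernel_form M (\<lambda>s t. G s t + H s t) \<phi> \<psi>
      = (LINT s|M. (LINT t|M. G s t * \<phi> t) * cnj (\<psi> s) + (LINT t|M. H s t * \<phi> t) * cnj (\<psi> s))"
    unfolding kernel_form_def
    using integrable_bounded_kernel_section[OF G _ \<phi>] integrable_bounded_kernel_section[OF H _ \<phi>]
    by (intro Bochner_Integration.integral_cong) (auto simp: distrib_right)
  then show ?thesis
    using integrable_kernel_form[OF M G \<phi> \<psi>] integrable_kernel_form[OF M H \<phi> \<psi>]
    by (simp add: kernel_form_def)
qed

lemma kernel_form_cong_AE:
  assumes G: "bounded_kernel M M G" and H: "bounded_kernel M M H" and \<phi>: "integrable M \<phi>"
    and eq: "\<And>s. s \<in> space M \<Longrightarrow> AE t in M. G s t = H s t"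
  shows "kernel_form M G \<phi> \<psi> = kernel_form M H \<phi> \<psi>"
  unfolding kernel_form_def
proof (rule Bochner_Integration.integral_cong[OF refl])
  fix s assume s: "s \<in> space M"
  have "(LINT t|M. G s t * \<phi> t) = (LINT t|M. H s t * \<phi> t)"
  proof (rule integral_cong_AE)
    show "AE t in M. G s t * \<phi> t = H s t * \<phi> t" using eq[OF s] by eventually_elim simp
  qed (use integrable_bounded_kernel_section[OF G s \<phi>] integrable_bounded_kernel_section[OF H s \<phi>]
      in \<open>auto intro: borel_measurable_integrable\<close>)
  then show "(LINT t|M. G s t * \<phi> t) * cnj (\<psi> s) = (LINT t|M. H s t * \<phi> t) * cnj (\<psi> s)" by simp
qed

lemma kernel_form_adjoint:
  assumes M: "sigma_finite_measure M" and H: "bounded_kernel M M H"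
    and \<phi>: "integrable M \<phi>" and \<psi>: "integrable M \<psi>"
  shows "kernel_form M (\<lambda>s t. cnj (H t s)) \<phi> \<psi> = cnj (kernel_form M H \<psi> \<phi>)"
proof -
  have "kernel_form M (\<lambda>s t. cnj (H t s)) \<phi> \<psi> = (LINT t|M. (LINT s|M. cnj (H t s) * cnj (\<psi> s)) * \<phi> t)"
    unfolding kernel_form_def
    using \<psi> by (intro bounded_kernel_Fubini M bounded_kernel_cnj bounded_kernel_transpose[OF H] \<phi>) simp
  also have "\<dots> = (LINT t|M. cnj (LINT s|M. H t s * \<psi> s) * \<phi> t)"
    by (simp only: complex_cnj_mult[symmetric] Bochner_Integration.integral_cnj)
  also have "\<dots> = (LINT t|M. cnj ((LINT s|M. H t s * \<psi> s) * cnj (\<phi> t)))"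
    by (simp only: complex_cnj_mult complex_cnj_cnj)
  also have "\<dots> = cnj (kernel_form M H \<psi> \<phi>)"
    unfolding kernel_form_def by (rule Bochner_Integration.integral_cnj)
  finally show ?thesis .
qed

lemma kernel_form_separable:
  "kernel_form M (\<lambda>s t. A t * cnj (B s)) \<phi> \<psi> = (LINT t|M. A t * \<phi> t) * cnj (LINT s|M. B s * \<psi> s)"
proof -
  have "(LINT t|M. A t * cnj (B s) * \<phi> t) = (LINT t|M. A t * \<phi> t) * cnj (B s)" for s
    by (subst integral_mult_left_zero[symmetric]) (simp add: mult_ac)
  then have "kernel_form M (\<lambda>s t. A t * cnj (B s)) \<phi> \<psi>
      = (LINT s|M. (LINT t|M. A t * \<phi> t) * cnj (B s * \<psi> s))"
    unfolding kernel_form_def by (simp add: mult.assoc)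
  then show ?thesis by (simp only: integral_mult_right_zero Bochner_Integration.integral_cnj)
qed

text \<open>
  If a kernel is the composition of an operator from functions on \<open>M\<close> to functions on \<open>N\<close> with an
  adjoint of such an operator, then its form is an inner product on \<open>N\<close>. This turns the kernel
  identity of the damped system into an identity between quadratic forms.
\<close>

lemma kernel_form_factored:
  assumes N: "finite_measure N" and M: "sigma_finite_measure M"
    and G: "bounded_kernel N M G" and H: "bounded_kernel N M H"
    and \<phi>: "integrable M \<phi>" and \<psi>: "integrable M \<psi>"
  shows "kernel_form M (\<lambda>s t. LINT z|N. G z t * cnj (H z s)) \<phi> \<psi> =
    (LINT z|N. (LINT t|M. G z t * \<phi> t) * cnj (LINT s|M. H z s * \<psi> s))"
proof -
  interpret N: finite_measure N by fact
  define u where "u z = (LINT t|M. G z t * \<phi> t)" for z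
  obtain C where "\<forall>z\<in>space N. norm (u z) \<le> C"
    using bounded_kernel_integral(2)[OF M G \<phi>] unfolding u_def by blast
  then have u: "integrable N u"
    using bounded_kernel_integral(1)[OF M G \<phi>] unfolding u_def[abs_def]
    by (intro N.integrable_const_bound[where B=C] AE_I2) auto
  have inner: "(LINT t|M. (LINT z|N. G z t * cnj (H z s)) * \<phi> t) = (LINT z|N. cnj (H z s) * u z)"
    if s: "s \<in> space M" for s
  proof -
    have sec: "bounded_kernel N M (\<lambda>z t. H z s)"
    proof -
      obtain B where B: "\<And>z t. z \<in> space N \<Longrightarrow> t \<in> space M \<Longrightarrow> norm (H z t) \<le> B"
        using bounded_kernel_bound[OF H] by metis
      show ?thesis
        using bounded_kernel_section[OF bounded_kernel_transpose[OF H] s] B[OF _ s]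
        by (rule bounded_kernel_left)
    qed
    have "(LINT z|N. (LINT t|M. (G z t * cnj (H z s)) * \<phi> t) * 1)
        = (LINT t|M. (LINT z|N. (G z t * cnj (H z s)) * 1) * \<phi> t)"
      by (intro bounded_kernel_Fubini N.sigma_finite_measure_axioms M bounded_kernel_mult G
          bounded_kernel_cnj sec \<phi>) simp
    moreover have "(LINT t|M. (G z t * cnj (H z s)) * \<phi> t) = cnj (H z s) * u z" for z
      unfolding u_def by (subst integral_mult_right_zero[symmetric]) (simp add: mult_ac)
    ultimately show ?thesis by simp
  qed
  have "kernel_form M (\<lambda>s t. LINT z|N. G z t * cnj (H z s)) \<phi> \<psi>
      = (LINT s|M. (LINT z|N. cnj (H z s) * u z) * cnj (\<psi> s))"
    unfolding kernel_form_def by (intro Bochner_Integration.integral_cong) (simp_all add: inner)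
  also have "\<dots> = (LINT z|N. (LINT s|M. cnj (H z s) * cnj (\<psi> s)) * u z)"
    using \<psi> by (intro bounded_kernel_Fubini M N.sigma_finite_measure_axioms u
        bounded_kernel_cnj bounded_kernel_transpose[OF H]) simp
  also have "\<dots> = (LINT z|N. u z * cnj (LINT s|M. H z s * \<psi> s))"
    by (simp only: complex_cnj_mult[symmetric] Bochner_Integration.integral_cnj) (simp add: mult.commute)
  finally show ?thesis unfolding u_def .
qed

lemma bounded_kernel_compose:
  assumes N: "finite_measure N" and G: "bounded_kernel N M G" and H: "bounded_kernel N M H"
  shows "bounded_kernel M M (\<lambda>s t. LINT z|N. G z t * cnj (H z s))"
proof -
  interpret finite_measure N by fact
  note [measurable] = bounded_kernel_measurable[OF G] bounded_kernel_measurable[OF bounded_kernel_cnj[OF H]]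
  obtain A where A: "0 \<le> A" "\<And>z t. z \<in> space N \<Longrightarrow> t \<in> space M \<Longrightarrow> norm (G z t) \<le> A"
    using bounded_kernel_bound[OF G] by metis
  obtain B where B: "0 \<le> B" "\<And>z t. z \<in> space N \<Longrightarrow> t \<in> space M \<Longrightarrow> norm (H z t) \<le> B"
    using bounded_kernel_bound[OF H] by metis
  show ?thesis
  proof (rule bounded_kernelI[where B="A * B * measure N (space N)"])
    show "(\<lambda>(s, t). LINT z|N. G z t * cnj (H z s)) \<in> borel_measurable (M \<Otimes>\<^sub>M M)"
      by measurable
    fix s t assume s: "s \<in> space M" and t: "t \<in> space M"
    have le: "norm (G z t * cnj (H z s)) \<le> A * B" if "z \<in> space N" for z
      unfolding norm_mult complex_mod_cnj using A B s t that by (intro mult_mono) auto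
    have "integrable N (\<lambda>z. G z t * cnj (H z s))"
      using s t le by (intro integrable_const_bound[where B="A * B"] AE_I2) auto
    then have "(LINT z|N. norm (G z t * cnj (H z s))) \<le> (LINT z|N. A * B)"
      using le by (intro integral_mono integrable_norm) auto
    then show "norm (LINT z|N. G z t * cnj (H z s)) \<le> A * B * measure N (space N)"
      by (intro order_trans[OF integral_norm_bound]) (simp add: mult_ac)
  qed
qed

lemma kernel_form_sum:
  assumes M: "sigma_finite_measure M" and H: "\<And>q. q \<in> I \<Longrightarrow> bounded_kernel M M (H q)"
    and \<phi>: "integrable M \<phi>" and \<psi>: "integrable M \<psi>"
  shows "kernel_form M (\<lambda>s t. \<Sum>q\<in>I. H q s t) \<phi> \<psi> = (\<Sum>q\<in>I. kernel_form M (H q) \<phi> \<psi>)"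
  using H
proof (induction I rule: infinite_finite_induct)
  case (insert q I)
  have "kernel_form M (\<lambda>s t. H q s t + (\<Sum>q\<in>I. H q s t)) \<phi> \<psi>
      = kernel_form M (H q) \<phi> \<psi> + kernel_form M (\<lambda>s t. \<Sum>q\<in>I. H q s t) \<phi> \<psi>"
    using insert.prems by (intro kernel_form_add M \<phi> \<psi> bounded_kernel_sum) auto
  then show ?case using insert by simp
qed (simp_all add: kernel_form_def)

section \<open>Vector-valued functions and square integrability\<close>

lemma complex_vec_norm_le: "norm v \<le> (\<Sum>i\<in>UNIV. norm (v $ i))" for v :: "complex^'n"
  unfolding norm_vec_def by (rule L2_set_le_sum) auto

lemma complex_vec_measurable:
  fixes f :: "'a \<Rightarrow> complex^'n"
  assumes "\<And>i. (\<lambda>x. f x $ i) \<in> borel_measurable M"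
  shows "f \<in> borel_measurable M"
proof -
  have "(\<lambda>x. \<Sum>i\<in>UNIV. axis i (f x $ i)) \<in> borel_measurable M"
  proof (rule borel_measurable_sum)
    fix i :: 'n
    have "continuous_on UNIV (axis i :: complex \<Rightarrow> complex^'n)"
      by (intro linear_continuous_on linear_conv_bounded_linear[THEN iffD1])
        (auto simp: linear_iff vec_eq_iff axis_def)
    from borel_measurable_continuous_onI[OF this] assms[of i]
    show "(\<lambda>x. axis i (f x $ i) :: complex^'n) \<in> borel_measurable M"
      by (rule measurable_compose[rotated])
  qed
  also have "(\<lambda>x. \<Sum>i\<in>UNIV. axis i (f x $ i)) = f"
    by (intro ext, simp add: vec_eq_iff axis_def if_distrib cong: if_cong)
  finally show ?thesis .
qed

lemma vec_nth_measurable [measurable (raw)]: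
  fixes f :: "'a \<Rightarrow> complex^'n"
  assumes "f \<in> borel_measurable M"
  shows "(\<lambda>x. f x $ i) \<in> borel_measurable M"
  by (intro measurable_compose[OF assms] borel_measurable_continuous_onI continuous_intros)

lemma complex_vec_integrable:
  fixes f :: "'a \<Rightarrow> complex^'n"
  assumes "\<And>i. integrable M (\<lambda>x. f x $ i)"
  shows "integrable M f"
proof (rule Bochner_Integration.integrable_bound)
  show "integrable M (\<lambda>x. \<Sum>i\<in>UNIV. norm (f x $ i))" using assms by auto
  show "f \<in> borel_measurable M"
    by (intro complex_vec_measurable borel_measurable_integrable assms)
  show "AE x in M. norm (f x) \<le> norm (\<Sum>i\<in>UNIV. norm (f x $ i))"
    using complex_vec_norm_le by (intro AE_I2) (simp add: sum_nonneg)
qed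

lemma integral_vec_nth:
  fixes f :: "'a \<Rightarrow> complex^'n"
  assumes "integrable M f"
  shows "(LINT x|M. f x) $ i = (LINT x|M. f x $ i)"
  by (rule integral_bounded_linear[OF bounded_linear_vec_nth assms, symmetric])

definition cinner :: "complex^'n \<Rightarrow> complex^'n \<Rightarrow> complex" where
  "cinner v w = (\<Sum>i\<in>UNIV. v $ i * cnj (w $ i))"

lemma Re_cinner: "Re (cinner v w) = v \<bullet> w"
  by (simp add: cinner_def inner_vec_def inner_complex_def)

lemma cinner_same: "cinner v v = of_real ((norm v)\<^sup>2)"
proof -
  have "cinner v v = of_real (\<Sum>i\<in>UNIV. (norm (v $ i))\<^sup>2)"
    by (simp add: cinner_def complex_norm_square[symmetric])
  also have "(\<Sum>i\<in>UNIV. (norm (v $ i))\<^sup>2) = (norm v)\<^sup>2"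
    by (simp add: norm_vec_def L2_set_def sum_nonneg)
  finally show ?thesis .
qed

lemma finite_measure_leb_on: "finite_measure (leb_on l)"
  by (rule finite_measure_lebesgue_on) auto

definition L2_sq :: "real \<Rightarrow> (real \<Rightarrow> complex^'p) \<Rightarrow> real" where
  "L2_sq l f = (LINT x|leb_on l. (norm (f x))\<^sup>2)"

lemma L2_norm_sqrt: "L2_norm l f = sqrt (L2_sq l f)"
  by (simp add: L2_norm_def L2_sq_def)

lemma L2_sq_nonneg [simp]: "0 \<le> L2_sq l f"
  by (simp add: L2_sq_def)

lemma L2_measurable [measurable_dest]: "f \<in> L2 l \<Longrightarrow> f \<in> borel_measurable (leb_on l)"
  by (simp add: L2_def)

lemma L2_integrable_square: "f \<in> L2 l \<Longrightarrow> integrable (leb_on l) (\<lambda>x. (norm (f x))\<^sup>2)"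
  by (simp add: L2_def)

lemma L2_bound:
  assumes "f \<in> borel_measurable (leb_on l)" "integrable (leb_on l) g"
    and "\<And>x. x \<in> {0<..<l} \<Longrightarrow> (norm (f x))\<^sup>2 \<le> g x"
  shows "f \<in> L2 l" "L2_sq l f \<le> (LINT x|leb_on l. g x)"
proof -
  have "integrable (leb_on l) (\<lambda>x. (norm (f x))\<^sup>2)"
    using assms by (intro Bochner_Integration.integrable_bound[OF assms(2)] AE_I2) force+
  then show "f \<in> L2 l" using assms by (simp add: L2_def)
  show "L2_sq l f \<le> (LINT x|leb_on l. g x)"
    unfolding L2_sq_def
    by (intro integral_mono assms \<open>integrable (leb_on l) (\<lambda>x. (norm (f x))\<^sup>2)\<close>) (use assms(3) in simp)
qed

lemma L2_integrable_norm:
  assumes "f \<in> L2 l"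
  shows "integrable (leb_on l) (\<lambda>x. norm (f x))"
proof (rule finite_measure.square_integrable_imp_integrable[OF finite_measure_leb_on])
  note [measurable] = L2_measurable[OF assms]
  show "(\<lambda>x. norm (f x)) \<in> borel_measurable (leb_on l)" by measurable
qed (rule L2_integrable_square[OF assms])

lemma L2_integrable_nth:
  assumes "f \<in> L2 l"
  shows "integrable (leb_on l) (\<lambda>x. f x $ i)"
  using assms
  by (intro Bochner_Integration.integrable_bound[OF L2_integrable_norm[OF assms]] AE_I2)
    (auto simp: Finite_Cartesian_Product.norm_nth_le)

lemma measure_leb_on: "0 \<le> l \<Longrightarrow> measure (leb_on l) {0<..<l} = l"
  by (simp add: measure_restrict_space)

lemma L2_integral_norm_le:
  assumes l: "0 < l" and f: "f \<in> L2 l"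
  shows "(LINT x|leb_on l. norm (f x)) \<le> sqrt l * L2_norm l f"
proof -
  interpret finite_measure "leb_on l" by (rule finite_measure_leb_on)
  define m where "m = (LINT x|leb_on l. norm (f x))"
  note [simp] = L2_integrable_norm[OF f] L2_integrable_square[OF f]
  have eq: "(norm (f x) - m / l)\<^sup>2 = (norm (f x))\<^sup>2 - 2 * (m / l) * norm (f x) + (m / l)\<^sup>2" for x
    by (simp add: power2_diff)
  have "0 \<le> (LINT x|leb_on l. (norm (f x) - m / l)\<^sup>2)" by (rule Bochner_Integration.integral_nonneg) simp
  also have "\<dots> = L2_sq l f - 2 * (m / l) * m + (m / l)\<^sup>2 * l"
    unfolding eq using l by (simp add: L2_sq_def m_def measure_leb_on)
  also have "\<dots> = L2_sq l f - m\<^sup>2 / l"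
    using l by (simp add: power2_eq_square)
  finally have "m\<^sup>2 / l \<le> L2_sq l f" by simp
  then have "m\<^sup>2 \<le> l * L2_sq l f" using l by (simp add: pos_divide_le_eq mult.commute)
  then have "m \<le> sqrt (l * L2_sq l f)" by (simp add: real_le_rsqrt)
  then show ?thesis unfolding m_def L2_norm_sqrt by (simp only: real_sqrt_mult)
qed

lemma L2_add:
  assumes "f \<in> L2 l" "g \<in> L2 l"
  shows "(\<lambda>x. f x + g x) \<in> L2 l" and "L2_sq l (\<lambda>x. f x + g x) \<le> 2 * L2_sq l f + 2 * L2_sq l g"
proof -
  have b: "(norm (f x + g x))\<^sup>2 \<le> 2 * (norm (f x))\<^sup>2 + 2 * (norm (g x))\<^sup>2" for x
  proof -
    have "(norm (f x + g x))\<^sup>2 \<le> (norm (f x) + norm (g x))\<^sup>2"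
      by (intro power_mono norm_triangle_ineq) auto
    also have "\<dots> \<le> 2 * (norm (f x))\<^sup>2 + 2 * (norm (g x))\<^sup>2"
      using sum_squares_bound[of "norm (f x)" "norm (g x)"] by (simp add: power2_sum)
    finally show ?thesis .
  qed
  note [simp] = L2_integrable_square[OF assms(1)] L2_integrable_square[OF assms(2)]
  have m: "(\<lambda>x. f x + g x) \<in> borel_measurable (leb_on l)"
    using assms[THEN L2_measurable] by measurable
  show "(\<lambda>x. f x + g x) \<in> L2 l"
    by (rule L2_bound(1)[OF m _ b]) simp
  show "L2_sq l (\<lambda>x. f x + g x) \<le> 2 * L2_sq l f + 2 * L2_sq l g"
    using L2_bound(2)[OF m _ b] by (simp add: L2_sq_def)
qed

lemma norm_vector_smult: "norm (c *s v) = norm c * norm v" for v :: "complex^'n"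
  by (simp add: norm_vec_def norm_mult L2_set_right_distrib)

lemma L2_smult:
  assumes "f \<in> L2 l"
  shows "(\<lambda>x. c *s f x) \<in> L2 l"
proof (rule L2_bound(1))
  note [measurable] = L2_measurable[OF assms]
  show "(\<lambda>x. c *s f x) \<in> borel_measurable (leb_on l)"
    by (rule complex_vec_measurable) simp
  show "integrable (leb_on l) (\<lambda>x. (norm c)\<^sup>2 * (norm (f x))\<^sup>2)"
    using L2_integrable_square[OF assms] by simp
qed (simp add: norm_vector_smult power_mult_distrib)

lemma scaleR_vec_conv: "r *\<^sub>R v = complex_of_real r *s v" for v :: "complex^'n"
  unfolding vec_eq_iff vector_scaleR_component vector_smult_component
  by (simp add: scaleR_conv_of_real)

lemma L2_scaleR: "f \<in> L2 l \<Longrightarrow> (\<lambda>x. r *\<^sub>R f x) \<in> L2 l"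
  unfolding scaleR_vec_conv by (rule L2_smult)

lemma L2_diff: "f \<in> L2 l \<Longrightarrow> g \<in> L2 l \<Longrightarrow> (\<lambda>x. f x - g x) \<in> L2 l"
  using L2_add(1)[of f l "\<lambda>x. (-1) *\<^sub>R g x"] L2_scaleR[of g l "-1"] by simp

lemma L2_sq_scaleR: "L2_sq l (\<lambda>x. r *\<^sub>R f x) = r\<^sup>2 * L2_sq l f"
  by (simp add: L2_sq_def power_mult_distrib)

lemma L2_integrable_inner:
  assumes "f \<in> L2 l" "g \<in> L2 l"
  shows "integrable (leb_on l) (\<lambda>x. f x \<bullet> g x)"
    and "integrable (leb_on l) (\<lambda>x. cinner (f x) (g x))"
proof -
  note [measurable] = assms[THEN L2_measurable]
  have [measurable]: "cnj \<in> borel_measurable borel"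
    by (intro borel_measurable_continuous_onI continuous_intros)
  have b: "norm (f x $ i * cnj (g x $ i)) \<le> (norm (f x))\<^sup>2 + (norm (g x))\<^sup>2" for x i
  proof -
    have "norm (f x $ i * cnj (g x $ i)) \<le> norm (f x) * norm (g x)"
      by (simp add: norm_mult mult_mono Finite_Cartesian_Product.norm_nth_le)
    also have "\<dots> \<le> (norm (f x))\<^sup>2 + (norm (g x))\<^sup>2"
    proof -
      have "0 \<le> norm (f x) * norm (g x)" by simp
      then show ?thesis
        using sum_squares_bound[of "norm (f x)" "norm (g x)"] by linarith
    qed
    finally show ?thesis .
  qed
  have "integrable (leb_on l) (\<lambda>x. f x $ i * cnj (g x $ i))" for i
  proof (rule Bochner_Integration.integrable_bound)
    show "integrable (leb_on l) (\<lambda>x. (norm (f x))\<^sup>2 + (norm (g x))\<^sup>2)"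
      using assms[THEN L2_integrable_square] by simp
    show "(\<lambda>x. f x $ i * cnj (g x $ i)) \<in> borel_measurable (leb_on l)" by measurable
  qed (use b in \<open>auto intro!: AE_I2\<close>)
  then show "integrable (leb_on l) (\<lambda>x. cinner (f x) (g x))"
    unfolding cinner_def by auto
  then have "integrable (leb_on l) (\<lambda>x. Re (cinner (f x) (g x)))"
    by simp
  then show "integrable (leb_on l) (\<lambda>x. f x \<bullet> g x)" by (simp add: Re_cinner)
qed

lemma Re_L2_inner:
  assumes "f \<in> L2 l" "g \<in> L2 l"
  shows "Re (L2_inner l f g) = (LINT x|leb_on l. f x \<bullet> g x)"
  using L2_integrable_inner(2)[OF assms] by (simp add: L2_inner_def cinner_def[symmetric] Re_cinner[symmetric])

lemma L2_sq_eq_0: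
  assumes "f \<in> L2 l" 
  shows "L2_sq l f = 0 \<longleftrightarrow> L2_eq l f (\<lambda>x. 0)"
  unfolding L2_sq_def L2_eq_def
  by (subst integral_nonneg_eq_0_iff_AE) (use assms in \<open>auto simp: L2_def\<close>)

section \<open>Operators of the second kind with bounded kernels\<close>

lemma L2_eq_refl: "L2_eq l f f"
  by (simp add: L2_eq_def)

lemma L2_eqI: "(\<And>x. x \<in> {0<..<l} \<Longrightarrow> f x = g x) \<Longrightarrow> L2_eq l f g"
  unfolding L2_eq_def by (intro AE_I2) simp

lemma L2_eq_mono:
  assumes "L2_eq l f g" "\<And>x. x \<in> {0<..<l} \<Longrightarrow> f x = g x \<Longrightarrow> f' x = g' x"
  shows "L2_eq l f' g'"
proof -
  have "AE x in leb_on l. f x = g x \<longrightarrow> f' x = g' x"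
    using assms(2) by (intro AE_I2) simp
  then show ?thesis
    using assms(1) unfolding L2_eq_def by (rule AE_mp[rotated])
qed

lemma L2_eq_sym: "L2_eq l f g \<Longrightarrow> L2_eq l g f"
  by (erule L2_eq_mono) simp

lemma L2_eq_trans:
  assumes "L2_eq l f g" "L2_eq l g h"
  shows "L2_eq l f h"
  using assms unfolding L2_eq_def by eventually_elim simp

lemma L2_sq_cong:
  assumes "f \<in> L2 l" "g \<in> L2 l" "L2_eq l f g"
  shows "L2_sq l f = L2_sq l g"
  unfolding L2_sq_def
proof (rule integral_cong_AE)
  note [measurable] = assms(1,2)[THEN L2_measurable]
  show "(\<lambda>x. (norm (f x))\<^sup>2) \<in> borel_measurable (leb_on l)" by measurable
  show "(\<lambda>x. (norm (g x))\<^sup>2) \<in> borel_measurable (leb_on l)" by measurable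
  show "AE x in leb_on l. (norm (f x))\<^sup>2 = (norm (g x))\<^sup>2"
    using assms(3) unfolding L2_eq_def by eventually_elim simp
qed

text \<open>
  The shape \<open>f \<mapsto> f + \<integral> \<kappa>(\<cdot>,t) f(t) dt\<close> is shared by the operator \<open>S\<close> and by the Volterra operator
  against which it is estimated.
\<close>

definition second_kind_op ::
  "real \<Rightarrow> (real \<Rightarrow> real \<Rightarrow> complex^'p^'p) \<Rightarrow> (real \<Rightarrow> complex^'p) \<Rightarrow> (real \<Rightarrow> complex^'p)" where
  "second_kind_op l \<kappa> f = (\<lambda>x. f x + (LINT t|leb_on l. \<kappa> x t *v f t))"

locale L2_kernel =
  fixes l :: real and \<kappa> :: "real \<Rightarrow> real \<Rightarrow> complex^'p^'p"
  assumes l_pos: "0 < l"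
    and kernel: "\<And>i j. bounded_kernel (leb_on l) (leb_on l) (\<lambda>x t. \<kappa> x t $ i $ j)"
begin

abbreviation S :: "(real \<Rightarrow> complex^'p) \<Rightarrow> (real \<Rightarrow> complex^'p)" where
  "S \<equiv> second_kind_op l \<kappa>"

definition K :: "(real \<Rightarrow> complex^'p) \<Rightarrow> (real \<Rightarrow> complex^'p)" where
  "K f x = (LINT t|leb_on l. \<kappa> x t *v f t)"

lemma S_eq: "S f x = f x + K f x"
  by (simp add: second_kind_op_def K_def)

lemma integrable_entry:
  assumes "f \<in> L2 l" "x \<in> {0<..<l}"
  shows "integrable (leb_on l) (\<lambda>t. \<kappa> x t $ i $ j * f t $ j)"
  using integrable_bounded_kernel_section[OF kernel _ L2_integrable_nth[OF assms(1)]] assms(2)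
  by simp

lemma integrable_kernel:
  assumes "f \<in> L2 l" "x \<in> {0<..<l}"
  shows "integrable (leb_on l) (\<lambda>t. \<kappa> x t *v f t)"
  by (rule complex_vec_integrable)
    (use integrable_entry[OF assms] in \<open>simp add: matrix_vector_mult_def\<close>)

lemma K_nth:
  assumes "f \<in> L2 l" "x \<in> {0<..<l}"
  shows "K f x $ i = (\<Sum>j\<in>UNIV. LINT t|leb_on l. \<kappa> x t $ i $ j * f t $ j)"
  using integrable_entry[OF assms] integrable_kernel[OF assms]
  by (simp add: K_def integral_vec_nth matrix_vector_mult_def)

lemma entry_bound:
  obtains B where "0 \<le> B"
    "\<And>i j x t. x \<in> {0<..<l} \<Longrightarrow> t \<in> {0<..<l} \<Longrightarrow> norm (\<kappa> x t $ i $ j) \<le> B"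
proof -
  have "\<exists>B. \<forall>x\<in>{0<..<l}. \<forall>t\<in>{0<..<l}. norm (\<kappa> x t $ i $ j) \<le> B" for i j
    using kernel[of i j] by (simp add: bounded_kernel_def)
  then obtain B where B: "\<And>i j x t. x \<in> {0<..<l} \<Longrightarrow> t \<in> {0<..<l} \<Longrightarrow> norm (\<kappa> x t $ i $ j) \<le> B i j"
    by metis
  show ?thesis
  proof (rule that[of "\<Sum>i\<in>UNIV. \<Sum>j\<in>UNIV. \<bar>B i j\<bar>"])
    fix i j x t assume xt: "x \<in> {0<..<l}" "t \<in> {0<..<l}"
    have "norm (\<kappa> x t $ i $ j) \<le> \<bar>B i j\<bar>" using B[OF xt] by (rule order_trans) simp
    also have "\<dots> \<le> (\<Sum>j\<in>UNIV. \<bar>B i j\<bar>)" by (rule member_le_sum) auto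
    also have "\<dots> \<le> (\<Sum>i\<in>UNIV. \<Sum>j\<in>UNIV. \<bar>B i j\<bar>)"
      by (rule member_le_sum[of i UNIV "\<lambda>i. \<Sum>j\<in>UNIV. \<bar>B i j\<bar>"]) (auto intro: sum_nonneg)
    finally show "norm (\<kappa> x t $ i $ j) \<le> (\<Sum>i\<in>UNIV. \<Sum>j\<in>UNIV. \<bar>B i j\<bar>)" .
  qed (intro sum_nonneg, simp)
qed

text \<open>
  A bounded kernel maps \<open>L\<^sup>2\<close> into bounded functions, with values controlled at every point and not
  only almost everywhere. This gain is what makes the series of \<open>S_surjective\<close> converge pointwise.
\<close>

lemma K_bound:
  obtains M where "0 \<le> M" "\<And>f x. f \<in> L2 l \<Longrightarrow> x \<in> {0<..<l} \<Longrightarrow> norm (K f x) \<le> M * L2_norm l f"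
proof -
  obtain B where B: "0 \<le> B"
    "\<And>i j x t. x \<in> {0<..<l} \<Longrightarrow> t \<in> {0<..<l} \<Longrightarrow> norm (\<kappa> x t $ i $ j) \<le> B"
    by (rule entry_bound) blast
  define p where "p = real CARD('p)"
  show ?thesis
  proof (rule that[of "p * (p * (B * sqrt l))"])
    fix f :: "real \<Rightarrow> complex^'p" and x assume f: "f \<in> L2 l" and x: "x \<in> {0<..<l}"
    have entry: "norm (LINT t|leb_on l. \<kappa> x t $ i $ j * f t $ j) \<le> B * sqrt l * L2_norm l f" for i j
    proof -
      have "norm (LINT t|leb_on l. \<kappa> x t $ i $ j * f t $ j) \<le> B * (LINT t|leb_on l. norm (f t $ j))"
        using B(2)[OF x] L2_integrable_nth[OF f] integrable_entry[OF f x]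
        by (intro kernel_integral_bound) auto
      also have "\<dots> \<le> B * (LINT t|leb_on l. norm (f t))"
        using L2_integrable_nth[OF f] L2_integrable_norm[OF f]
        by (intro mult_left_mono integral_mono B Finite_Cartesian_Product.norm_nth_le) auto
      also have "\<dots> \<le> B * (sqrt l * L2_norm l f)"
        by (intro mult_left_mono B L2_integral_norm_le l_pos f)
      finally show ?thesis by (simp add: mult.assoc)
    qed
    have "norm (K f x $ i) \<le> p * (B * sqrt l * L2_norm l f)" for i
      unfolding K_nth[OF f x] p_def by (rule sum_norm_bound) (rule entry)
    then have "(\<Sum>i\<in>UNIV. norm (K f x $ i)) \<le> p * (p * (B * sqrt l * L2_norm l f))"
      unfolding p_def by (rule sum_bounded_above)
    then show "norm (K f x) \<le> p * (p * (B * sqrt l)) * L2_norm l f"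
      using complex_vec_norm_le[of "K f x"] by (simp add: mult.assoc)
  qed (use B l_pos p_def in simp)
qed

lemma K_L2:
  assumes f: "f \<in> L2 l"
  shows "K f \<in> L2 l"
proof -
  interpret finite_measure "leb_on l" by (rule finite_measure_leb_on)
  obtain M where M: "\<And>f x. f \<in> L2 l \<Longrightarrow> x \<in> {0<..<l} \<Longrightarrow> norm (K f x) \<le> M * L2_norm l f"
    by (rule K_bound) blast
  have m: "(\<lambda>x. \<Sum>j\<in>UNIV. LINT t|leb_on l. \<kappa> x t $ i $ j * f t $ j) \<in> borel_measurable (leb_on l)" for i
    by (intro borel_measurable_sum bounded_kernel_integral(1)[OF sigma_finite_measure_axioms]
        kernel L2_integrable_nth f)
  have "(\<lambda>x. K f x $ i) \<in> borel_measurable (leb_on l)" for i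
    using m by (rule measurable_cong[THEN iffD1, rotated]) (simp add: K_nth[OF f])
  then have "K f \<in> borel_measurable (leb_on l)" by (rule complex_vec_measurable)
  then show ?thesis
    by (rule L2_bound(1)[where g="\<lambda>x. (M * L2_norm l f)\<^sup>2"]) (auto intro!: power_mono M f)
qed

lemma S_L2: "f \<in> L2 l \<Longrightarrow> S f \<in> L2 l"
  using L2_add(1)[OF _ K_L2] by (simp add: second_kind_op_def K_def)

lemma S_L2_bound:
  obtains C where "0 \<le> C" "\<And>f. f \<in> L2 l \<Longrightarrow> L2_sq l (S f) \<le> C * L2_sq l f"
proof -
  interpret finite_measure "leb_on l" by (rule finite_measure_leb_on)
  obtain M where M: "0 \<le> M" "\<And>f x. f \<in> L2 l \<Longrightarrow> x \<in> {0<..<l} \<Longrightarrow> norm (K f x) \<le> M * L2_norm l f"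
    by (rule K_bound) blast
  show ?thesis
  proof (rule that[of "2 + 2 * (l * M\<^sup>2)"])
    fix f :: "real \<Rightarrow> complex^'p" assume f: "f \<in> L2 l"
    have "L2_sq l (K f) \<le> (LINT x|leb_on l. (M * L2_norm l f)\<^sup>2)"
      by (rule L2_bound(2)) (auto intro!: power_mono M f L2_measurable K_L2)
    also have "\<dots> = l * M\<^sup>2 * L2_sq l f"
      using l_pos by (simp add: measure_leb_on power_mult_distrib L2_norm_sqrt)
    finally have "L2_sq l (K f) \<le> l * M\<^sup>2 * L2_sq l f" .
    moreover have "L2_sq l (S f) \<le> 2 * L2_sq l f + 2 * L2_sq l (K f)"
      using L2_add(2)[OF f K_L2[OF f]] by (simp add: second_kind_op_def K_def)
    ultimately show "L2_sq l (S f) \<le> (2 + 2 * (l * M\<^sup>2)) * L2_sq l f"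
      by (simp add: algebra_simps)
  qed (use l_pos in simp)
qed

lemma K_cong:
  assumes "f \<in> L2 l" "g \<in> L2 l" "L2_eq l f g" "x \<in> {0<..<l}"
  shows "K f x = K g x"
  unfolding K_def
proof (rule integral_cong_AE)
  show "AE t in leb_on l. \<kappa> x t *v f t = \<kappa> x t *v g t"
    using assms(3) unfolding L2_eq_def by eventually_elim simp
qed (use integrable_kernel assms in \<open>auto intro: borel_measurable_integrable\<close>)

lemma K_add:
  assumes "f \<in> L2 l" "g \<in> L2 l" "x \<in> {0<..<l}"
  shows "K (\<lambda>t. f t + g t) x = K f x + K g x"
  using integrable_kernel assms by (simp add: K_def matrix_vector_right_distrib)

lemma K_smult:
  assumes "f \<in> L2 l" "x \<in> {0<..<l}"
  shows "K (\<lambda>t. c *s f t) x = c *s K f x"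
  using integrable_entry[OF assms]
  by (simp add: vec_eq_iff K_nth[OF L2_smult[OF assms(1)] assms(2)] K_nth[OF assms] 
      sum_distrib_left mult.left_commute)

lemma S_cong:
  assumes "f \<in> L2 l" "g \<in> L2 l" "L2_eq l f g"
  shows "L2_eq l (S f) (S g)"
  by (rule L2_eq_mono[OF assms(3)]) (simp add: S_eq K_cong[OF assms])

lemma S_add: "f \<in> L2 l \<Longrightarrow> g \<in> L2 l \<Longrightarrow> x \<in> {0<..<l} \<Longrightarrow> S (\<lambda>t. f t + g t) x = S f x + S g x"
  by (simp add: S_eq K_add)

lemma S_smult: "f \<in> L2 l \<Longrightarrow> x \<in> {0<..<l} \<Longrightarrow> S (\<lambda>t. c *s f t) x = c *s S f x"
  by (simp add: S_eq K_smult vector_add_ldistrib)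

lemma S_scaleR: "f \<in> L2 l \<Longrightarrow> x \<in> {0<..<l} \<Longrightarrow> S (\<lambda>t. r *\<^sub>R f t) x = r *\<^sub>R S f x"
  unfolding scaleR_vec_conv by (rule S_smult)

lemma S_diff: 
  assumes "f \<in> L2 l" "g \<in> L2 l" "x \<in> {0<..<l}" shows "S (\<lambda>t. f t - g t) x = S f x - S g x"
  using S_add[of f "\<lambda>t. (-1) *\<^sub>R g t" x] S_scaleR[of g x "-1"] L2_scaleR[of g l "-1"] assms by simp

lemma bounded_operator_S: "bounded_operator_L2 l S"
  unfolding bounded_operator_L2_def
proof (intro conjI allI ballI impI)
  obtain C where C: "0 \<le> C" "\<And>f. f \<in> L2 l \<Longrightarrow> L2_sq l (S f) \<le> C * L2_sq l f"
    by (rule S_L2_bound) blast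
  have "\<forall>f\<in>L2 l. L2_norm l (S f) \<le> sqrt C * L2_norm l f"
    using C by (simp add: L2_norm_sqrt real_sqrt_mult[symmetric])
  then show "\<exists>C. \<forall>f\<in>L2 l. L2_norm l (S f) \<le> C * L2_norm l f" ..
qed (fact S_L2 S_cong | rule L2_eqI, fact S_add S_smult)+

end

section \<open>Coercive operators of the second kind\<close>

locale coercive_kernel = L2_kernel l \<kappa> for l and \<kappa> :: "real \<Rightarrow> real \<Rightarrow> complex^'p^'p" +
  fixes c :: real
  assumes c_pos: "0 < c"
    and coercive: "\<And>f. f \<in> L2 l \<Longrightarrow> c * L2_sq l f \<le> Re (L2_inner l (S f) f)"
begin

text \<open>
  Expand \<open>0 \<le> \<parallel>Sf - cf\<parallel>\<^sup>2\<close> and insert the coercivity.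
\<close>

lemma S_lower_bound:
  assumes f: "f \<in> L2 l"
  shows "c\<^sup>2 * L2_sq l f \<le> L2_sq l (S f)"
proof -
  note Sf = S_L2[OF f]
  have eq: "(norm (S f x - c *\<^sub>R f x))\<^sup>2 = (norm (S f x))\<^sup>2 - 2 * c * (S f x \<bullet> f x) + c\<^sup>2 * (norm (f x))\<^sup>2"
    for x
    unfolding power2_norm_eq_inner
    by (simp add: inner_diff_left inner_diff_right inner_commute algebra_simps power2_eq_square)
  have "0 \<le> (LINT x|leb_on l. (norm (S f x - c *\<^sub>R f x))\<^sup>2)" by simp
  also have "\<dots> = (LINT x|leb_on l. (norm (S f x))\<^sup>2 - 2 * c * (S f x \<bullet> f x) + c\<^sup>2 * (norm (f x))\<^sup>2)"
    unfolding eq ..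
  also have "\<dots> = L2_sq l (S f) - 2 * c * Re (L2_inner l (S f) f) + c\<^sup>2 * L2_sq l f"
    using L2_integrable_square[OF f] L2_integrable_square[OF Sf] L2_integrable_inner(1)[OF Sf f]
    by (simp add: Re_L2_inner[OF Sf f] L2_sq_def)
  finally have "2 * c * Re (L2_inner l (S f) f) \<le> L2_sq l (S f) + c\<^sup>2 * L2_sq l f" by simp
  moreover have "2 * c * (c * L2_sq l f) \<le> 2 * c * Re (L2_inner l (S f) f)"
    using coercive[OF f] c_pos by (intro mult_left_mono) auto
  ultimately show ?thesis by (simp add: power2_eq_square)
qed

lemma S_injective:
  assumes "f \<in> L2 l" "g \<in> L2 l" "L2_eq l (S f) (S g)"
  shows "L2_eq l f g"
proof -
  note d = L2_diff[OF assms(1,2)]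
  have "L2_eq l (S (\<lambda>x. f x - g x)) (\<lambda>x. 0)"
    by (rule L2_eq_mono[OF assms(3)]) (simp add: S_diff[OF assms(1,2)])
  then have "L2_sq l (S (\<lambda>x. f x - g x)) = 0"
    using L2_sq_eq_0[OF S_L2[OF d]] by simp
  then have "c\<^sup>2 * L2_sq l (\<lambda>x. f x - g x) \<le> 0" using S_lower_bound[OF d] by simp
  then have "L2_sq l (\<lambda>x. f x - g x) = 0"
    using c_pos L2_sq_nonneg[of l "\<lambda>x. f x - g x"] by (simp add: mult_le_0_iff)
  then have "L2_eq l (\<lambda>x. f x - g x) (\<lambda>x. 0)" using L2_sq_eq_0[OF d] by simp
  then show ?thesis by (simp add: L2_eq_def)
qed

end

context coercive_kernel
begin

text \<open>
  Since \<open>\<parallel>f - \<tau>Sf\<parallel>\<^sup>2 = \<parallel>f\<parallel>\<^sup>2 - 2\<tau> Re (Sf,f) + \<tau>\<^sup>2\<parallel>Sf\<parallel>\<^sup>2 \<le> (1 - 2\<tau>c + \<tau>\<^sup>2C) \<parallel>f\<parallel>\<^sup>2\<close>, a small step \<open>\<tau>\<close> against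
  \<open>S\<close> contracts the norm.
\<close>

lemma damped_step_contraction:
  obtains \<tau> q where "0 < \<tau>" "\<tau> < 1" "0 \<le> q" "q < 1"
    "\<And>f. f \<in> L2 l \<Longrightarrow> L2_norm l (\<lambda>x. f x - \<tau> *\<^sub>R S f x) \<le> q * L2_norm l f"
proof -
  obtain C where C: "0 \<le> C" "\<And>f. f \<in> L2 l \<Longrightarrow> L2_sq l (S f) \<le> C * L2_sq l f"
    by (rule S_L2_bound) blast
  \<comment> \<open>The step is small enough for \<open>\<tau>C \<le> c\<close>, which leaves \<open>1 - \<tau>c\<close>; the terms \<open>c\<^sup>2\<close> and \<open>1\<close> of \<open>N\<close>
    ensure \<open>\<tau>c < 1\<close> and \<open>\<tau> < 1\<close>.\<close>
  define N where "N = C + c\<^sup>2 + 1"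
  define \<tau> where "\<tau> = c / N"
  have N: "0 < N" using C(1) by (simp add: N_def add_nonneg_pos)
  have "c < N"
  proof -
    have "2 * c * 1 \<le> c\<^sup>2 + 1\<^sup>2" by (rule sum_squares_bound)
    then show ?thesis using c_pos C(1) by (simp add: N_def)
  qed
  have "c\<^sup>2 < N" "C \<le> N" using C(1) by (simp_all add: N_def)
  have \<tau>: "0 < \<tau>" "\<tau> < 1" "\<tau> * c < 1" "\<tau> * C \<le> c"
  proof -
    show "0 < \<tau>" "\<tau> < 1" using N c_pos \<open>c < N\<close> by (simp_all add: \<tau>_def)
    show "\<tau> * c < 1" using N \<open>c\<^sup>2 < N\<close> by (simp add: \<tau>_def power2_eq_square)
    have "\<tau> * C \<le> \<tau> * N" using \<open>0 < \<tau>\<close> \<open>C \<le> N\<close> by (intro mult_left_mono) auto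
    then show "\<tau> * C \<le> c" using N by (simp add: \<tau>_def)
  qed
  show ?thesis
  proof (rule that[of \<tau> "sqrt (1 - \<tau> * c)"])
    fix f :: "real \<Rightarrow> complex^'p" assume f: "f \<in> L2 l"
    note Sf = S_L2[OF f]
    have eq: "(norm (f x - \<tau> *\<^sub>R S f x))\<^sup>2
        = (norm (f x))\<^sup>2 - 2 * \<tau> * (S f x \<bullet> f x) + \<tau>\<^sup>2 * (norm (S f x))\<^sup>2" for x
      unfolding power2_norm_eq_inner
      by (simp add: inner_diff_left inner_diff_right inner_commute algebra_simps power2_eq_square)
    have "L2_sq l (\<lambda>x. f x - \<tau> *\<^sub>R S f x)
        = L2_sq l f - 2 * \<tau> * Re (L2_inner l (S f) f) + \<tau>\<^sup>2 * L2_sq l (S f)"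
      unfolding L2_sq_def eq
      using L2_integrable_square[OF f] L2_integrable_square[OF Sf] L2_integrable_inner(1)[OF Sf f]
      by (simp add: Re_L2_inner[OF Sf f])
    also have "\<dots> \<le> L2_sq l f - 2 * \<tau> * (c * L2_sq l f) + \<tau>\<^sup>2 * (C * L2_sq l f)"
      using \<tau>(1) by (intro add_mono diff_mono mult_left_mono coercive C(2) f order_refl) auto
    also have "\<dots> = (1 - 2 * \<tau> * c + \<tau> * (\<tau> * C)) * L2_sq l f"
      by (simp add: algebra_simps power2_eq_square)
    also have "\<dots> \<le> (1 - 2 * \<tau> * c + \<tau> * c) * L2_sq l f"
      using \<tau> by (intro mult_right_mono add_left_mono mult_left_mono) auto
    also have "\<dots> = (1 - \<tau> * c) * L2_sq l f" by (simp add: algebra_simps)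
    finally show "L2_norm l (\<lambda>x. f x - \<tau> *\<^sub>R S f x) \<le> sqrt (1 - \<tau> * c) * L2_norm l f"
      unfolding L2_norm_sqrt real_sqrt_mult[symmetric] by (rule real_sqrt_le_mono)
  qed (use \<tau> c_pos in simp_all)
qed

text \<open>
  The solution of \<open>Sh = f\<close> is the Neumann series \<open>h = \<tau> \<Sum>n. r n\<close> with \<open>r n = (1 - \<tau>S)\<^sup>n f\<close>. The norms
  \<open>\<parallel>r n\<parallel>\<close> decay geometrically. Writing one step as \<open>r (n+1) = (1 - \<tau>) r n - \<tau> K (r n)\<close>, where
  \<open>\<bar>K (r n) x\<bar> \<le> M \<parallel>r n\<parallel>\<close>, one finds that \<open>\<tau> \<Sum>n. \<bar>r n x\<bar>\<close> is at most \<open>\<bar>f x\<bar>\<close> plus a constant, at every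
  point \<open>x\<close>. So the series converges pointwise with an integrable majorant, and dominated
  convergence gives \<open>Sh = f\<close> at every point.
\<close>

lemma S_surjective:
  assumes f: "f \<in> L2 l"
  obtains h where "h \<in> L2 l" "\<And>x. x \<in> {0<..<l} \<Longrightarrow> S h x = f x"
proof -
  interpret finite_measure "leb_on l" by (rule finite_measure_leb_on)
  obtain \<tau> q where \<tau>: "0 < \<tau>" "\<tau> < 1" and q: "0 \<le> q" "q < 1"
    and contraction: "\<And>f. f \<in> L2 l \<Longrightarrow> L2_norm l (\<lambda>x. f x - \<tau> *\<^sub>R S f x) \<le> q * L2_norm l f"
    by (rule damped_step_contraction) blast
  obtain M where M: "0 \<le> M" "\<And>f x. f \<in> L2 l \<Longrightarrow> x \<in> {0<..<l} \<Longrightarrow> norm (K f x) \<le> M * L2_norm l f"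
    by (rule K_bound) blast
  define r where "r n = ((\<lambda>g x. g x - \<tau> *\<^sub>R S g x) ^^ n) f" for n
  have r_0: "r 0 = f" by (simp add: r_def)
  have r_Suc: "r (Suc n) x = r n x - \<tau> *\<^sub>R S (r n) x" for n x
    by (simp add: r_def)
  have r_L2: "r n \<in> L2 l" for n
  proof (induction n)
    case (Suc n)
    then have "(\<lambda>x. r n x - \<tau> *\<^sub>R S (r n) x) \<in> L2 l" by (intro L2_diff L2_scaleR S_L2)
    then show ?case by (simp add: r_Suc[abs_def])
  qed (simp add: r_0 f)
  have r_norm: "L2_norm l (r n) \<le> q ^ n * L2_norm l f" for n
  proof (induction n)
    case (Suc n)
    have "L2_norm l (r (Suc n)) \<le> q * L2_norm l (r n)"
      using contraction[OF r_L2] by (simp add: r_Suc[abs_def])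
    also have "\<dots> \<le> q * (q ^ n * L2_norm l f)" using Suc q(1) by (intro mult_left_mono)
    finally show ?case by (simp add: mult.assoc)
  qed (simp add: r_0)
  define F where "F = M * L2_norm l f * (1 / (1 - q))"
  have F: "0 \<le> F" using M(1) q by (simp add: F_def L2_norm_sqrt)
  have partial: "\<tau> * (\<Sum>n<N. norm (r n x)) \<le> norm (f x) + \<tau> * F" if x: "x \<in> {0<..<l}" for x N
  proof -
    have step: "norm (r (Suc n) x) \<le> (1 - \<tau>) * norm (r n x) + \<tau> * (M * (q ^ n * L2_norm l f))" for n
    proof -
      have "r (Suc n) x = (1 - \<tau>) *\<^sub>R r n x - \<tau> *\<^sub>R K (r n) x"
        by (simp add: r_Suc S_eq algebra_simps)
      also have "norm \<dots> \<le> (1 - \<tau>) * norm (r n x) + \<tau> * norm (K (r n) x)"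
        using norm_triangle_ineq4[of "(1 - \<tau>) *\<^sub>R r n x" "\<tau> *\<^sub>R K (r n) x"] \<tau> by simp
      also have "norm (K (r n) x) \<le> M * L2_norm l (r n)" by (rule M(2)[OF r_L2 x])
      also have "\<dots> \<le> M * (q ^ n * L2_norm l f)" by (intro mult_left_mono r_norm M(1))
      finally show ?thesis using \<tau>(1) by simp
    qed
    have geo: "(\<Sum>n<N. q ^ n) \<le> 1 / (1 - q)"
    proof -
      have "(\<Sum>n<N. q ^ n) \<le> suminf ((^) q)"
        using q by (intro sum_le_suminf summable_geometric) auto
      then show ?thesis using q by (simp add: suminf_geometric)
    qed
    have "(\<Sum>n<N. norm (r n x)) \<le> (\<Sum>n<Suc N. norm (r n x))" by simp
    also have "\<dots> = norm (f x) + (\<Sum>n<N. norm (r (Suc n) x))"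
      by (subst sum.lessThan_Suc_shift) (simp add: r_0)
    also have "\<dots> \<le> norm (f x) + (\<Sum>n<N. (1 - \<tau>) * norm (r n x) + \<tau> * (M * (q ^ n * L2_norm l f)))"
      by (intro add_left_mono sum_mono step)
    also have "\<dots> = norm (f x) + (1 - \<tau>) * (\<Sum>n<N. norm (r n x))
        + \<tau> * (M * L2_norm l f * (\<Sum>n<N. q ^ n))"
      by (simp add: sum.distrib sum_distrib_left mult_ac)
    also have "\<dots> \<le> norm (f x) + (1 - \<tau>) * (\<Sum>n<N. norm (r n x)) + \<tau> * F"
      unfolding F_def using \<tau>(1) M(1)
      by (intro add_left_mono mult_left_mono geo) (auto simp: L2_norm_sqrt)
    \<comment> \<open>The sum occurs on both sides; subtracting \<open>1 - \<tau>\<close> times it leaves the factor \<open>\<tau>\<close>.\<close>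
    finally show ?thesis by (simp add: algebra_simps)
  qed
  have summable: "summable (\<lambda>n. r n x)" if x: "x \<in> {0<..<l}" for x
  proof (rule summable_norm_cancel, rule bounded_imp_summable[where B="(norm (f x) + \<tau> * F) / \<tau>"])
    show "(\<Sum>n\<le>N. norm (r n x)) \<le> (norm (f x) + \<tau> * F) / \<tau>" for N
      using partial[OF x, of "Suc N"] \<tau>(1)
      by (simp only: lessThan_Suc_atMost pos_le_divide_eq mult.commute)
  qed simp
  define s where "s N x = \<tau> *\<^sub>R (\<Sum>n<N. r n x)" for N x
  define h where "h x = \<tau> *\<^sub>R (\<Sum>n. r n x)" for x
  have s_bound: "norm (s N x) \<le> norm (f x) + \<tau> * F" if x: "x \<in> {0<..<l}" for N x
  proof -
    have "norm (s N x) \<le> \<tau> * (\<Sum>n<N. norm (r n x))"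
      using \<tau>(1) by (simp add: s_def norm_sum)
    then show ?thesis using partial[OF x, of N] by linarith
  qed
  have s_lim: "(\<lambda>N. s N x) \<longlonglongrightarrow> h x" if x: "x \<in> {0<..<l}" for x
    unfolding s_def h_def
    by (intro tendsto_scaleR tendsto_const summable_LIMSEQ summable x)
  have h_bound: "norm (h x) \<le> norm (f x) + \<tau> * F" if x: "x \<in> {0<..<l}" for x
    using tendsto_norm[OF s_lim[OF x]] by (rule LIMSEQ_le_const2) (use s_bound[OF x] in auto)
  have s_Suc: "s (Suc N) x = s N x + \<tau> *\<^sub>R r N x" for N x
    by (simp add: s_def scaleR_add_right)
  have s_L2: "s N \<in> L2 l" for N
  proof (induction N)
    case 0
    have "(\<lambda>x. 0 *\<^sub>R f x) \<in> L2 l" by (rule L2_scaleR[OF f])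
    then show ?case by (simp add: s_def[abs_def])
  next
    case (Suc N)
    then have "(\<lambda>x. s N x + \<tau> *\<^sub>R r N x) \<in> L2 l" by (intro L2_add L2_scaleR r_L2)
    then show ?case by (simp add: s_Suc[abs_def])
  qed
  have S_s: "S (s N) x = f x - r N x" if x: "x \<in> {0<..<l}" for N x
  proof (induction N)
    case 0
    have "S (\<lambda>x. 0 *\<^sub>R f x) x = 0 *\<^sub>R S f x" by (rule S_scaleR[OF f x])
    then show ?case by (simp add: s_def[abs_def] r_0)
  next
    case (Suc N)
    have "S (s (Suc N)) x = S (s N) x + \<tau> *\<^sub>R S (r N) x"
      using S_add[OF s_L2 L2_scaleR[OF r_L2] x] S_scaleR[OF r_L2 x] by (simp add: s_Suc[abs_def])
    then show ?case using Suc by (simp add: r_Suc)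
  qed
  have h_L2: "h \<in> L2 l"
  proof (rule L2_bound(1))
    show "h \<in> borel_measurable (leb_on l)"
      using s_lim by (intro borel_measurable_LIMSEQ_metric[OF L2_measurable[OF s_L2]]) simp
    show "integrable (leb_on l) (\<lambda>x. 2 * (norm (f x))\<^sup>2 + 2 * (\<tau> * F)\<^sup>2)"
      using L2_integrable_square[OF f] by simp
    show "(norm (h x))\<^sup>2 \<le> 2 * (norm (f x))\<^sup>2 + 2 * (\<tau> * F)\<^sup>2" if x: "x \<in> {0<..<l}" for x
    proof -
      have "(norm (h x))\<^sup>2 \<le> (norm (f x) + \<tau> * F)\<^sup>2" by (intro power_mono h_bound x) simp
      then show ?thesis
        using sum_squares_bound[of "norm (f x)" "\<tau> * F"] by (simp add: power2_sum)
    qed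
  qed
  have "S h x = f x" if x: "x \<in> {0<..<l}" for x
  proof -
    have K_lim: "(\<lambda>N. K (s N) x) \<longlonglongrightarrow> K h x"
    proof (rule Finite_Cartesian_Product.vec_tendstoI)
      fix i
      have "(\<lambda>N. LINT t|leb_on l. \<kappa> x t $ i $ j * s N t $ j)
          \<longlonglongrightarrow> (LINT t|leb_on l. \<kappa> x t $ i $ j * h t $ j)" for j
      proof -
        obtain B where B: "0 \<le> B" 
          "\<And>i j x t. x \<in> {0<..<l} \<Longrightarrow> t \<in> {0<..<l} \<Longrightarrow> norm (\<kappa> x t $ i $ j) \<le> B"
          by (rule entry_bound) blast
        show ?thesis
        proof (rule integral_dominated_convergence[where w="\<lambda>t. B * (norm (f t) + \<tau> * F)"])
          show "(\<lambda>t. \<kappa> x t $ i $ j * h t $ j) \<in> borel_measurable (leb_on l)"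
            "\<And>N. (\<lambda>t. \<kappa> x t $ i $ j * s N t $ j) \<in> borel_measurable (leb_on l)"
            using integrable_entry[OF h_L2 x] integrable_entry[OF s_L2 x]
            by (auto intro: borel_measurable_integrable)
          show "integrable (leb_on l) (\<lambda>t. B * (norm (f t) + \<tau> * F))"
            using L2_integrable_norm[OF f] by simp
          show "AE t in leb_on l. (\<lambda>N. \<kappa> x t $ i $ j * s N t $ j) \<longlonglongrightarrow> \<kappa> x t $ i $ j * h t $ j"
            by (intro AE_I2 tendsto_mult tendsto_const tendsto_vec_nth s_lim) simp
          show "AE t in leb_on l. norm (\<kappa> x t $ i $ j * s N t $ j) \<le> B * (norm (f t) + \<tau> * F)" for N
          proof (intro AE_I2)
            fix t assume "t \<in> space (leb_on l)"
            then have t: "t \<in> {0<..<l}" by simp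
            have "norm (s N t $ j) \<le> norm (f t) + \<tau> * F"
              using Finite_Cartesian_Product.norm_nth_le[of "s N t" j] s_bound[OF t, of N] by linarith
            then show "norm (\<kappa> x t $ i $ j * s N t $ j) \<le> B * (norm (f t) + \<tau> * F)"
              unfolding norm_mult by (intro mult_mono B x t) auto
          qed
        qed
      qed
      then show "(\<lambda>N. K (s N) x $ i) \<longlonglongrightarrow> K h x $ i"
        unfolding K_nth[OF s_L2 x] K_nth[OF h_L2 x] by (intro tendsto_sum)
    qed
    have "(\<lambda>N. S (s N) x) \<longlonglongrightarrow> S h x"
      unfolding S_eq by (intro tendsto_add s_lim K_lim x)
    moreover have "(\<lambda>N. S (s N) x) \<longlonglongrightarrow> f x - 0"
      unfolding S_s[OF x]
      by (intro tendsto_diff tendsto_const summable_LIMSEQ_zero summable x)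
    ultimately show ?thesis using LIMSEQ_unique by fastforce
  qed
  with h_L2 that show ?thesis by blast
qed

text \<open>
  Solutions exist by \<open>S_surjective\<close> and are unique up to null sets by \<open>S_injective\<close>; uniqueness gives
  the linearity of any choice of solutions and its compatibility with equality almost everywhere.
\<close>

theorem boundedly_invertible_S: "boundedly_invertible_L2 l S"
proof -
  define R where "R f = (SOME h. h \<in> L2 l \<and> (\<forall>x\<in>{0<..<l}. S h x = f x))" for f :: "real \<Rightarrow> complex^'p"
  have "R f \<in> L2 l \<and> (\<forall>x\<in>{0<..<l}. S (R f) x = f x)" if "f \<in> L2 l" for f
  proof -
    have "\<exists>h. h \<in> L2 l \<and> (\<forall>x\<in>{0<..<l}. S h x = f x)"
      by (rule S_surjective[OF that]) blast
    then show ?thesis unfolding R_def by (rule someI_ex)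
  qed
  then have R: "R f \<in> L2 l" "\<And>x. x \<in> {0<..<l} \<Longrightarrow> S (R f) x = f x" if "f \<in> L2 l" for f
    using that by auto
  have SR: "L2_eq l (S (R f)) f" if "f \<in> L2 l" for f
    using R[OF that] by (intro L2_eqI)
  have unique: "L2_eq l h (R f)" if "h \<in> L2 l" "f \<in> L2 l" "L2_eq l (S h) f" for h f
    by (rule S_injective[OF that(1) R(1)[OF that(2)] L2_eq_trans[OF that(3) L2_eq_sym[OF SR[OF that(2)]]]])
  have "bounded_operator_L2 l R"
    unfolding bounded_operator_L2_def
  proof (intro conjI ballI allI impI)
    fix f g :: "real \<Rightarrow> complex^'p" and a :: complex
    assume f: "f \<in> L2 l"
    show "R f \<in> L2 l" by (rule R[OF f])
    have "L2_eq l (\<lambda>x. a *s R f x) (R (\<lambda>x. a *s f x))"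
    proof (rule unique)
      show "L2_eq l (S (\<lambda>x. a *s R f x)) (\<lambda>x. a *s f x)"
        by (rule L2_eqI) (simp add: S_smult R[OF f])
    qed (intro L2_smult R f)+
    then show "L2_eq l (R (\<lambda>x. a *s f x)) (\<lambda>x. a *s R f x)" by (rule L2_eq_sym)
    assume g: "g \<in> L2 l"
    have "L2_eq l (\<lambda>x. R f x + R g x) (R (\<lambda>x. f x + g x))"
    proof (rule unique)
      show "L2_eq l (S (\<lambda>x. R f x + R g x)) (\<lambda>x. f x + g x)"
        by (rule L2_eqI) (simp add: S_add R[OF f] R[OF g])
    qed (intro L2_add R f g)+
    then show "L2_eq l (R (\<lambda>x. f x + g x)) (\<lambda>x. R f x + R g x)" by (rule L2_eq_sym)
    assume "L2_eq l f g"
    then show "L2_eq l (R f) (R g)"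
      by (rule unique[OF R(1)[OF f] g L2_eq_trans[OF SR[OF f]]])
  next
    have "L2_norm l (R f) \<le> (1 / c) * L2_norm l f" if f: "f \<in> L2 l" for f
    proof -
      have "L2_sq l (S (R f)) = L2_sq l f"
        by (rule L2_sq_cong[OF S_L2[OF R(1)[OF f]] f SR[OF f]])
      then have "c\<^sup>2 * L2_sq l (R f) \<le> L2_sq l f"
        using S_lower_bound[OF R(1)[OF f]] by simp
      then have "sqrt (c\<^sup>2 * L2_sq l (R f)) \<le> L2_norm l f"
        unfolding L2_norm_sqrt by (rule real_sqrt_le_mono)
      then show ?thesis
        using c_pos by (simp add: real_sqrt_mult L2_norm_sqrt field_simps)
    qed
    then show "\<exists>C. \<forall>f\<in>L2 l. L2_norm l (R f) \<le> C * L2_norm l f" by blast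
  qed
  moreover have "L2_eq l (R (S f)) f" if "f \<in> L2 l" for f
    using unique[OF that S_L2[OF that] L2_eq_refl] by (rule L2_eq_sym)
  ultimately show ?thesis
    unfolding boundedly_invertible_L2_def using SR by blast
qed

end

section \<open>Inner products and forms\<close>

lemma cinner_add_left: "cinner (u + v) w = cinner u w + cinner v w"
  by (simp add: cinner_def distrib_right sum.distrib)

lemma cinner_add_right: "cinner u (v + w) = cinner u v + cinner u w"
  by (simp add: cinner_def distrib_left sum.distrib)

lemma cnj_cinner: "cnj (cinner u v) = cinner v u"
  by (simp add: cinner_def mult.commute)

lemma bounded_bilinear_cinner: "bounded_bilinear (cinner :: complex^'n \<Rightarrow> complex^'n \<Rightarrow> complex)"
proof
  fix u v w :: "complex^'n" and r :: real
  show "cinner (u + v) w = cinner u w + cinner v w" by (rule cinner_add_left)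
  show "cinner u (v + w) = cinner u v + cinner u w" by (rule cinner_add_right)
  show "cinner (r *\<^sub>R u) v = r *\<^sub>R cinner u v"
    unfolding cinner_def vector_scaleR_component by (simp add: scaleR_sum_right)
  show "cinner u (r *\<^sub>R v) = r *\<^sub>R cinner u v"
    unfolding cinner_def vector_scaleR_component by (simp add: scaleR_sum_right)
  show "\<exists>K. \<forall>u v::complex^'n. norm (cinner u v) \<le> norm u * norm v * K"
  proof (intro exI allI)
    fix u v :: "complex^'n"
    have "norm (cinner u v) \<le> (\<Sum>i\<in>(UNIV::'n set). norm u * norm v)"
      unfolding cinner_def
      by (rule order_trans[OF norm_sum sum_mono])
        (simp add: norm_mult mult_mono Finite_Cartesian_Product.norm_nth_le)
    then show "norm (cinner u v) \<le> norm u * norm v * real CARD('n)"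
      by (simp add: mult.commute)
  qed
qed

lemma (in L2_kernel) L2_inner_K:
  assumes f: "f \<in> L2 l"
  shows "L2_inner l (K f) f =
    (\<Sum>i\<in>UNIV. \<Sum>j\<in>UNIV. kernel_form (leb_on l) (\<lambda>s t. \<kappa> s t $ i $ j) (\<lambda>t. f t $ j) (\<lambda>t. f t $ i))"
proof -
  interpret finite_measure "leb_on l" by (rule finite_measure_leb_on)
  have "L2_inner l (K f) f = (LINT s|leb_on l. (\<Sum>i\<in>UNIV. (\<Sum>j\<in>UNIV.
      (LINT t|leb_on l. \<kappa> s t $ i $ j * f t $ j) * cnj (f s $ i))))"
    unfolding L2_inner_def
    by (intro Bochner_Integration.integral_cong refl sum.cong) (simp add: K_nth[OF f] sum_distrib_right)
  also have "\<dots> = (\<Sum>i\<in>UNIV. \<Sum>j\<in>UNIV. kernel_form (leb_on l) (\<lambda>s t. \<kappa> s t $ i $ j)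
      (\<lambda>t. f t $ j) (\<lambda>t. f t $ i))"
    unfolding kernel_form_def
    using integrable_kernel_form[OF sigma_finite_measure_axioms kernel
        L2_integrable_nth[OF f] L2_integrable_nth[OF f]]
    by simp
  finally show ?thesis .
qed

lemma (in L2_kernel) L2_inner_S:
  assumes f: "f \<in> L2 l"
  shows "L2_inner l (S f) f = of_real (L2_sq l f) + L2_inner l (K f) f"
proof -
  have "L2_inner l (S f) f = (LINT s|leb_on l. of_real ((norm (f s))\<^sup>2) + cinner (K f s) (f s))"
    unfolding L2_inner_def cinner_def[symmetric] by (simp add: S_eq cinner_add_left cinner_same)
  also have "\<dots> = of_real (L2_sq l f) + L2_inner l (K f) f"
    using L2_integrable_square[OF f] L2_integrable_inner(2)[OF K_L2[OF f] f]
    unfolding L2_inner_def cinner_def[symmetric] L2_sq_def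
    by (simp del: of_real_power)
  finally show ?thesis .
qed

lemma (in L2_kernel) L2_sq_S:
  assumes f: "f \<in> L2 l"
  shows "L2_sq l (S f) = L2_sq l f + 2 * Re (L2_inner l (K f) f) + L2_sq l (K f)"
proof -
  note Kf = K_L2[OF f]
  have eq: "(norm (S f x))\<^sup>2 = (norm (f x))\<^sup>2 + 2 * (K f x \<bullet> f x) + (norm (K f x))\<^sup>2" for x
    unfolding S_eq power2_norm_eq_inner by (simp add: inner_add_left inner_add_right inner_commute)
  show ?thesis
    unfolding L2_sq_def eq
    using L2_integrable_square[OF f] L2_integrable_square[OF Kf] L2_integrable_inner(1)[OF Kf f]
    by (simp add: Re_L2_inner[OF Kf f])
qed

lemma L2_sq_components:
  assumes "f \<in> L2 l"
  shows "L2_sq l f = (\<Sum>i\<in>UNIV. LINT x|leb_on l. (norm (f x $ i))\<^sup>2)"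
proof -
  have "integrable (leb_on l) (\<lambda>x. (norm (f x $ i))\<^sup>2)" for i
  proof (rule Bochner_Integration.integrable_bound[OF L2_integrable_square[OF assms]])
    note [measurable] = L2_measurable[OF assms]
    show "(\<lambda>x. (norm (f x $ i))\<^sup>2) \<in> borel_measurable (leb_on l)" by measurable
  qed (auto intro!: power_mono Finite_Cartesian_Product.norm_nth_le)
  moreover have "(norm (f x))\<^sup>2 = (\<Sum>i\<in>UNIV. (norm (f x $ i))\<^sup>2)" for x
    by (simp add: norm_vec_def L2_set_def sum_nonneg)
  ultimately show ?thesis unfolding L2_sq_def by simp
qed

section \<open>The quadratic form of a damped system\<close>

text \<open>
  The trajectory \<open>a i\<close> starts in the input vector \<open>a i 0\<close> of the \<open>i\<close>-th channel and loses energy at the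
  rate prescribed by the damping vectors \<open>\<delta> q\<close>. The axiom \<open>damping\<close> is the polarised form of
  \<open>d/dy \<parallel>a i y\<parallel>\<^sup>2 = - \<Sum>q. \<bar>\<langle>a i y, \<delta> q\<rangle>\<bar>\<^sup>2 / d q\<close>, stated at two unrelated times because the inputs
  of two channels enter at different times.
\<close>

locale damped_system =
  fixes d :: "'p::finite \<Rightarrow> real" and l L :: real
    and a a' :: "'p \<Rightarrow> real \<Rightarrow> complex^'n" and \<delta> :: "'p \<Rightarrow> complex^'n"
  assumes l_pos: "0 < l" and d_pos: "\<And>i. 0 < d i" and d_le: "\<And>i. d i * l \<le> L"
    and deriv: "\<And>i y. (a i has_vector_derivative a' i y) (at y)"
    and damping: "\<And>i j x y. cinner (a' i x) (a j y) + cinner (a i x) (a' j y) =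
      - (\<Sum>q\<in>UNIV. cinner (a i x) (\<delta> q) * cnj (cinner (a j y) (\<delta> q)) / d q)"
begin

abbreviation M :: "real measure" where "M \<equiv> leb_on l"
abbreviation N :: "real measure" where "N \<equiv> lebesgue_on {0..L}"

text \<open>
  The signal \<open>f t $ j\<close> enters channel \<open>j\<close> at time \<open>d j * t\<close>, and \<open>output_kernel j q\<close> is its contribution
  to the damping output \<open>\<langle>U(z), \<delta> q\<rangle>\<close> of the state \<open>U\<close> at time \<open>z\<close>. The Volterra kernel is the same
  output, read off at the entrance time \<open>d i * s\<close> of channel \<open>i\<close>.
\<close>

definition output_kernel :: "'p \<Rightarrow> 'p \<Rightarrow> real \<Rightarrow> real \<Rightarrow> complex" where
  "output_kernel j q z t = (if d j * t \<le> z then cinner (a j (z - d j * t)) (\<delta> q) else 0)"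

definition volterra_kernel :: "real \<Rightarrow> real \<Rightarrow> complex^'p^'p" where
  "volterra_kernel s t = (\<chi> i j. output_kernel j i (d i * s) t)"

text \<open>
  The D-difference kernel of the theorem, written with \<open>a i 0\<close> and \<open>a i 0 + \<delta> i\<close> for the columns of
  \<open>\<Theta>\<^sub>1\<close> and \<open>\<Theta>\<^sub>2\<close>. The arbitrary values \<open>e i j\<close> on the lines \<open>d i * s = d j * t\<close> stand for the
  unspecified \<open>k 0\<close>.
\<close>

definition damped_kernel :: "('p \<Rightarrow> 'p \<Rightarrow> complex) \<Rightarrow> real \<Rightarrow> real \<Rightarrow> complex^'p^'p" where
  "damped_kernel e s t = (\<chi> i j. let y = d i * s - d j * t in
     if 0 < y then cinner (a j y) (a i 0 + \<delta> i)
     else if y < 0 then cnj (cinner (a i (- y)) (a j 0 + \<delta> j))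
     else e i j)"

lemma finite_N: "finite_measure N"
  by (rule finite_measure_lebesgue_on) auto

lemma sigma_M: "sigma_finite_measure M"
  using finite_measure_leb_on by (rule finite_measure.axioms(1))

lemma L_pos: "0 < L"
  using d_le mult_pos_pos[OF d_pos l_pos] by (rule less_le_trans[rotated])

lemma dt_range: "t \<in> {0<..<l} \<Longrightarrow> 0 < d j * t \<and> d j * t < L"
  using less_le_trans[OF mult_strict_left_mono[of t l "d j"] d_le[of j]] d_pos[of j] by simp

lemma continuous_a: "continuous_on A (a i)"
  by (intro continuous_at_imp_continuous_on ballI has_vector_derivative_continuous[OF deriv])

lemma continuous_cinner_a:
  "continuous_on A f \<Longrightarrow> continuous_on A (\<lambda>y. cinner (a i (f y)) w)"
  by (intro bounded_bilinear.continuous_on[OF bounded_bilinear_cinner] continuous_intros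
      continuous_on_compose2[OF continuous_a]) auto

lemma measurable_cinner_a [measurable]: "(\<lambda>y. cinner (a i y) w) \<in> borel_measurable borel"
  by (intro borel_measurable_continuous_onI continuous_cinner_a continuous_intros)

lemma measurable_a_nth [measurable]: "(\<lambda>y. a i y $ r) \<in> borel_measurable borel"
  by (intro borel_measurable_continuous_onI continuous_intros continuous_a)

lemma lebesgue_ident [measurable]: "(\<lambda>x. x) \<in> borel_measurable (lebesgue_on A)"
  by (intro measurable_restrict_space1 measurable_completion) simp

lemma cinner_a_bound:
  obtains B where "0 \<le> B" "\<And>y i. y \<in> {0..L} \<Longrightarrow> norm (cinner (a i y) w) \<le> B"
proof -
  have "\<exists>B. \<forall>y\<in>{0..L}. norm (cinner (a i y) w) \<le> B" for i
  proof -
    have "bounded ((\<lambda>y. cinner (a i y) w) ` {0..L})"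
      by (intro compact_imp_bounded compact_continuous_image continuous_cinner_a continuous_on_id compact_Icc)
    then show ?thesis by (auto simp: bounded_iff)
  qed
  then obtain B where B: "\<And>y i. y \<in> {0..L} \<Longrightarrow> norm (cinner (a i y) w) \<le> B i" by metis
  show ?thesis
  proof (rule that[of "\<Sum>i\<in>UNIV. \<bar>B i\<bar>"])
    fix y i assume "y \<in> {0..L}"
    then have "norm (cinner (a i y) w) \<le> \<bar>B i\<bar>" using B[of y i] by linarith
    also have "\<dots> \<le> (\<Sum>i\<in>UNIV. \<bar>B i\<bar>)" by (rule member_le_sum) auto
    finally show "norm (cinner (a i y) w) \<le> (\<Sum>i\<in>UNIV. \<bar>B i\<bar>)" .
  qed (simp add: sum_nonneg)
qed

lemma bounded_kernel_output: "bounded_kernel N M (output_kernel j q)"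
proof -
  obtain B where B: "0 \<le> B" "\<And>y i. y \<in> {0..L} \<Longrightarrow> norm (cinner (a i y) (\<delta> q)) \<le> B"
    by (rule cinner_a_bound) blast
  show ?thesis
  proof (rule bounded_kernelI[where B=B])
    show "case_prod (output_kernel j q) \<in> borel_measurable (N \<Otimes>\<^sub>M M)"
      unfolding output_kernel_def by measurable
    fix z t assume "z \<in> space N" "t \<in> space M"
    then show "norm (output_kernel j q z t) \<le> B"
      using B dt_range[of t j] by (auto simp: output_kernel_def)
  qed
qed

lemma bounded_kernel_volterra: "bounded_kernel M M (\<lambda>s t. volterra_kernel s t $ i $ j)"
proof -
  obtain B where B: "0 \<le> B" "\<And>y k. y \<in> {0..L} \<Longrightarrow> norm (cinner (a k y) (\<delta> i)) \<le> B"
    by (rule cinner_a_bound) blast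
  show ?thesis
  proof (rule bounded_kernelI[where B=B])
    show "(\<lambda>(s, t). volterra_kernel s t $ i $ j) \<in> borel_measurable (M \<Otimes>\<^sub>M M)"
      unfolding volterra_kernel_def output_kernel_def vec_lambda_beta by measurable
    fix s t assume "s \<in> space M" "t \<in> space M"
    then show "norm (volterra_kernel s t $ i $ j) \<le> B"
      using B dt_range[of t j] dt_range[of s i] by (auto simp: output_kernel_def volterra_kernel_def)
  qed
qed

lemma bounded_kernel_damped: "bounded_kernel M M (\<lambda>s t. damped_kernel e s t $ i $ j)"
proof -
  have [measurable]: "cnj \<in> borel_measurable borel"
    by (intro borel_measurable_continuous_onI continuous_intros)
  obtain B where B: "0 \<le> B" "\<And>y k. y \<in> {0..L} \<Longrightarrow> norm (cinner (a k y) (a i 0 + \<delta> i)) \<le> B"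
    by (rule cinner_a_bound) blast
  obtain C where C: "0 \<le> C" "\<And>y k. y \<in> {0..L} \<Longrightarrow> norm (cinner (a k y) (a j 0 + \<delta> j)) \<le> C"
    by (rule cinner_a_bound) blast
  show ?thesis
  proof (rule bounded_kernelI[where B="B + C + norm (e i j)"])
    show "(\<lambda>(s, t). damped_kernel e s t $ i $ j) \<in> borel_measurable (M \<Otimes>\<^sub>M M)"
      unfolding damped_kernel_def vec_lambda_beta Let_def by measurable
    fix s t assume "s \<in> space M" "t \<in> space M"
    then have st: "0 < d j * t" "d j * t < L" "0 < d i * s" "d i * s < L"
      using dt_range[of t j] dt_range[of s i] by auto
    consider "d j * t < d i * s" | "d i * s < d j * t" | "d i * s = d j * t" by linarith
    then show "norm (damped_kernel e s t $ i $ j) \<le> B + C + norm (e i j)"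
    proof cases
      case 1
      then have "norm (damped_kernel e s t $ i $ j) \<le> B"
        using st B(2)[of "d i * s - d j * t" j] by (simp add: damped_kernel_def)
      then show ?thesis using C(1) by (simp add: add_increasing2)
    next
      case 2
      then have "norm (damped_kernel e s t $ i $ j) \<le> C"
        using st C(2)[of "d j * t - d i * s" i] by (simp add: damped_kernel_def)
      then show ?thesis using B(1) by (simp add: add_increasing2 add_increasing)
    next
      case 3
      then show ?thesis using B(1) C(1) by (simp add: damped_kernel_def)
    qed
  qed
qed

text \<open>
  The kernels of the energy that is dissipated up to time \<open>L\<close> and of the energy \<open>\<parallel>U(L)\<parallel>\<^sup>2\<close> that is then
  still present.
\<close>

definition dissipation_kernel :: "'p \<Rightarrow> 'p \<Rightarrow> real \<Rightarrow> real \<Rightarrow> complex" where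
  "dissipation_kernel i j s t = (\<Sum>q\<in>UNIV. LINT z|N. (output_kernel j q z t / d q) * cnj (output_kernel i q z s))"

definition final_kernel :: "'p \<Rightarrow> 'p \<Rightarrow> real \<Rightarrow> real \<Rightarrow> complex" where
  "final_kernel i j s t = (\<Sum>r\<in>UNIV. a j (L - d j * t) $ r * cnj (a i (L - d i * s) $ r))"

text \<open>
  Two trajectories interact only after both have been started, that is from time \<open>m\<close> on. Integrating
  the damping law over \<open>[m, L]\<close> shows that the energy at time \<open>m\<close> is the dissipated energy plus the
  final one.
\<close>

lemma energy_balance:
  fixes i j :: 'p
  assumes s: "s \<in> {0<..<l}" and t: "t \<in> {0<..<l}"
  defines "m \<equiv> max (d i * s) (d j * t)"
  shows "dissipation_kernel i j s t + final_kernel i j s t =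
    cinner (a j (m - d j * t)) (a i (m - d i * s))"
proof -
  define F where "F z = cinner (a j (z - d j * t)) (a i (z - d i * s))" for z
  define F' where "F' z = - (\<Sum>q\<in>UNIV. cinner (a j (z - d j * t)) (\<delta> q) *
    cnj (cinner (a i (z - d i * s)) (\<delta> q)) / d q)" for z
  have m: "0 < m" "m < L" "d i * s \<le> m" "d j * t \<le> m"
    using dt_range[OF s, of i] dt_range[OF t, of j] by (auto simp: m_def)
  have shift: "((\<lambda>z. a k (z - c)) has_vector_derivative a' k (z - c)) (at z)" for k c z
  proof -
    have "((\<lambda>z. z - c) has_vector_derivative 1) (at z)"
      unfolding has_real_derivative_iff_has_vector_derivative[symmetric]
      by (auto intro!: derivative_eq_intros)
    from vector_diff_chain_at[OF this deriv] show ?thesis by (simp add: o_def)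
  qed
  have "(F has_vector_derivative F' z) (at z)" for z
    unfolding F_def F'_def damping[symmetric]
    using bounded_bilinear.has_vector_derivative[OF bounded_bilinear_cinner
        shift[of j "d j * t" z] shift[of i "d i * s" z]]
    by (simp add: add.commute)
  then have "(F has_vector_derivative F' z) (at z within {m..L})" for z
    by (rule has_vector_derivative_at_within)
  moreover have "continuous_on {m..L} F'"
    unfolding F'_def using d_pos
    by (intro continuous_intros continuous_cinner_a) (auto simp: less_imp_neq[THEN not_sym])
  ultimately have FTC: "(LBINT z. indicator {m..L} z *\<^sub>R F' z) = F L - F m"
    using m by (intro integral_FTC_atLeastAtMost) auto
  have F'_meas: "F' \<in> borel_measurable borel"
    unfolding F'_def using d_pos
    by (intro borel_measurable_continuous_onI continuous_intros continuous_cinner_a)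
      (auto simp: less_imp_neq[THEN not_sym])
  have int: "integrable N (\<lambda>z. (output_kernel j q z t / d q) * cnj (output_kernel i q z s))" for q
  proof -
    interpret N: finite_measure N by (rule finite_N)
    have "bounded_kernel N M (\<lambda>z t. (1 / d q) * output_kernel j q z t)"
      by (intro bounded_kernel_mult bounded_kernel_const bounded_kernel_output)
    from bounded_kernel_transpose[OF this]
    have G: "bounded_kernel M N (\<lambda>t z. (1 / d q) * output_kernel j q z t)" .
    have H: "bounded_kernel M N (\<lambda>t z. cnj (output_kernel i q z t))"
      by (rule bounded_kernel_cnj[OF bounded_kernel_transpose[OF bounded_kernel_output]])
    have "integrable N (\<lambda>z. cnj (output_kernel i q z s) * 1)"
      by (rule integrable_bounded_kernel_section[OF H]) (use s in auto)
    from integrable_bounded_kernel_section[OF G _ this, of t] t show ?thesis by simp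
  qed
  have "dissipation_kernel i j s t = (LINT z|N. (\<Sum>q\<in>UNIV. (output_kernel j q z t / d q) * cnj (output_kernel i q z s)))"
    unfolding dissipation_kernel_def using int by simp
  also have "\<dots> = (LINT z|lebesgue. indicator {0..L} z *\<^sub>R
      (\<Sum>q\<in>UNIV. (output_kernel j q z t / d q) * cnj (output_kernel i q z s)))"
    by (rule integral_restrict_space) simp
  also have "\<dots> = (LINT z|lebesgue. - (indicator {m..L} z *\<^sub>R F' z))"
    using m by (intro Bochner_Integration.integral_cong)
      (auto simp: F'_def output_kernel_def indicator_def m_def intro!: sum.cong)
  also have "\<dots> = (LBINT z. - (indicator {m..L} z *\<^sub>R F' z))"
    using F'_meas by (intro integral_completion) auto
  also have "\<dots> = F m - F L" using FTC by simp
  finally show ?thesis by (simp add: F_def final_kernel_def cinner_def)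
qed

text \<open>
  At time \<open>m\<close> the later of the two trajectories sits in its input vector, so that the right-hand side
  of \<open>energy_balance\<close> is the part of the kernel with \<open>a i 0\<close> or \<open>a j 0\<close>. The part with \<open>\<delta> i\<close> or \<open>\<delta> j\<close>
  is the Volterra kernel or its adjoint, according to which signal enters first.
\<close>

lemma damped_kernel_decomposition:
  assumes s: "s \<in> {0<..<l}" and t: "t \<in> {0<..<l}" and ne: "d i * s \<noteq> d j * t"
  shows "damped_kernel e s t $ i $ j = volterra_kernel s t $ i $ j + cnj (volterra_kernel t s $ j $ i)
    + (dissipation_kernel i j s t + final_kernel i j s t)"
  using ne unfolding energy_balance[OF s t]
  by (cases "d j * t < d i * s")
    (auto simp: damped_kernel_def Let_def volterra_kernel_def output_kernel_def cinner_add_right cnj_cinner max_def)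

end

lemma sum_rotate:
  "(\<Sum>i\<in>A. \<Sum>j\<in>B. \<Sum>q\<in>C. F i j q) = (\<Sum>q\<in>C. \<Sum>i\<in>A. \<Sum>j\<in>B. F i j q)"
proof -
  have "(\<Sum>i\<in>A. \<Sum>j\<in>B. \<Sum>q\<in>C. F i j q) = (\<Sum>i\<in>A. \<Sum>q\<in>C. \<Sum>j\<in>B. F i j q)"
    by (rule sum.cong[OF refl], rule sum.swap)
  also have "\<dots> = (\<Sum>q\<in>C. \<Sum>i\<in>A. \<Sum>j\<in>B. F i j q)" by (rule sum.swap)
  finally show ?thesis .
qed

lemma integral_dilation_le:
  fixes G :: "real \<Rightarrow> real"
  assumes G: "integrable (lebesgue_on {0..L}) G" "\<And>z. 0 \<le> G z" and c: "0 < c" "c * l \<le> L"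
  shows "(LINT s|leb_on l. G (c * s)) \<le> (LINT z|lebesgue_on {0..L}. G z) / c"
proof -
  define F where "F z = indicator {0<..<c * l} z * G z" for z
  have G': "integrable lebesgue (\<lambda>z. indicator {0..L} z * G z)"
    using G(1) by (simp add: integrable_restrict_space)
  have F: "F z = indicator {0<..<c * l} z * (indicator {0..L} z * G z)" for z
    using c(2) by (auto simp: F_def indicator_def)
  have "integrable lebesgue (\<lambda>z. F z)"
    unfolding F using integrable_mult_indicator[of "{0<..<c * l}" lebesgue, OF _ G'] by simp
  then have "(LINT z|lebesgue. F z) \<le> (LINT z|lebesgue. indicator {0..L} z * G z)"
  proof (rule integral_mono[OF _ G'])
    show "F z \<le> indicator {0..L} z * G z" for z
      using G(2) c(2) by (auto simp: F_def indicator_def)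
  qed
  also have "\<dots> = (LINT z|lebesgue_on {0..L}. G z)"
    by (simp add: integral_restrict_space)
  finally have "(LINT z|lebesgue. F z) \<le> (LINT z|lebesgue_on {0..L}. G z)" .
  moreover have "(LINT z|lebesgue. F z) = c * (LINT s|lebesgue. F (0 + c * s))"
    using lebesgue_integral_real_affine[of c F 0] c by simp
  moreover have "(LINT s|lebesgue. F (0 + c * s)) = (LINT s|leb_on l. G (c * s))"
    using c by (simp add: integral_restrict_space F_def indicator_def zero_less_mult_iff)
  ultimately show ?thesis using c by (simp add: pos_le_divide_eq mult.commute)
qed

context damped_system
begin

sublocale V: L2_kernel l volterra_kernel
  by unfold_locales (rule l_pos, rule bounded_kernel_volterra)

lemma L2_kernel_damped: "L2_kernel l (damped_kernel e)"
  by unfold_locales (rule l_pos, rule bounded_kernel_damped)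

definition damping_output :: "(real \<Rightarrow> complex^'p) \<Rightarrow> 'p \<Rightarrow> real \<Rightarrow> complex" where
  "damping_output f q z = (\<Sum>j\<in>UNIV. LINT t|M. output_kernel j q z t * f t $ j)"

definition final_state :: "(real \<Rightarrow> complex^'p) \<Rightarrow> complex^'n" where
  "final_state f = (\<chi> r. \<Sum>j\<in>UNIV. LINT t|M. a j (L - d j * t) $ r * f t $ j)"

lemma volterra_eq_output:
  assumes "f \<in> L2 l" "s \<in> {0<..<l}"
  shows "V.K f s $ i = damping_output f i (d i * s)"
  by (simp add: V.K_nth[OF assms] damping_output_def volterra_kernel_def)

lemma integrable_output_product:
  assumes f: "f \<in> L2 l"
  shows "integrable N (\<lambda>z. (LINT t|M. output_kernel j q z t * f t $ j) *
    cnj (LINT t|M. output_kernel i q z t * f t $ i))"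
proof -
  interpret N: finite_measure N by (rule finite_N)
  have *: "bounded_kernel N N (\<lambda>z _. LINT t|M. output_kernel j q z t * f t $ j)" for j
  proof -
    note int = bounded_kernel_integral[OF sigma_M bounded_kernel_output L2_integrable_nth[OF f], of j q j]
    obtain C where "\<forall>z\<in>space N. norm (LINT t|M. output_kernel j q z t * f t $ j) \<le> C"
      using int(2) by blast
    then show ?thesis by (intro bounded_kernel_left[OF int(1), of C]) simp
  qed
  have "bounded_kernel N N (\<lambda>z _. (LINT t|M. output_kernel j q z t * f t $ j) *
      cnj (LINT t|M. output_kernel i q z t * f t $ i))"
    by (rule bounded_kernel_mult[OF * bounded_kernel_cnj[OF *]])
  from integrable_bounded_kernel_section[OF bounded_kernel_transpose[OF this], of L "\<lambda>_. 1"] L_pos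
  show ?thesis by simp
qed

lemma output_square:
  "of_real ((norm (damping_output f q z))\<^sup>2) = (\<Sum>i\<in>UNIV. \<Sum>j\<in>UNIV.
     (LINT t|M. output_kernel j q z t * f t $ j) * cnj (LINT t|M. output_kernel i q z t * f t $ i))"
  unfolding complex_norm_square damping_output_def cnj_sum sum_product by (rule sum.swap)

lemma integrable_output_square:
  assumes f: "f \<in> L2 l"
  shows "integrable N (\<lambda>z. (norm (damping_output f q z))\<^sup>2)"
proof -
  have "integrable N (\<lambda>z. complex_of_real ((norm (damping_output f q z))\<^sup>2))"
    unfolding output_square using integrable_output_product[OF f] by simp
  then have "integrable N (\<lambda>z. Re (complex_of_real ((norm (damping_output f q z))\<^sup>2)))"
    by (rule integrable_Re)
  then show ?thesis by simp
qed

lemma bounded_kernel_dissipation_term: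
  "bounded_kernel M M (\<lambda>s t. LINT z|N. (output_kernel j q z t / d q) * cnj (output_kernel i q z s))"
proof (rule bounded_kernel_compose[OF finite_N])
  have "bounded_kernel N M (\<lambda>z t. (1 / d q) * output_kernel j q z t)"
    by (intro bounded_kernel_mult bounded_kernel_const bounded_kernel_output)
  then show "bounded_kernel N M (\<lambda>z t. output_kernel j q z t / d q)" by simp
qed (rule bounded_kernel_output)

lemma bounded_kernel_dissipation: "bounded_kernel M M (dissipation_kernel i j)"
  unfolding dissipation_kernel_def by (rule bounded_kernel_sum) (rule bounded_kernel_dissipation_term)

lemma bounded_kernel_final_term:
  "bounded_kernel M M (\<lambda>s t. a j (L - d j * t) $ r * cnj (a i (L - d i * s) $ r))"
proof -
  have nth: "v $ r = cinner v (axis r 1)" for v :: "complex^'n"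
    by (simp add: cinner_def axis_def if_distrib cong: if_cong)
  obtain B where B: "0 \<le> B" "\<And>y i. y \<in> {0..L} \<Longrightarrow> norm (cinner (a i y) (axis r 1)) \<le> B"
    by (rule cinner_a_bound) blast
  have *: "bounded_kernel M M (\<lambda>s t. a i (L - d i * s) $ r)" for i
  proof (rule bounded_kernel_left)
    show "(\<lambda>s. a i (L - d i * s) $ r) \<in> borel_measurable M" by measurable
    fix s assume "s \<in> space M"
    then show "norm (a i (L - d i * s) $ r) \<le> B"
      unfolding nth using dt_range[of s i] by (intro B) auto
  qed
  show ?thesis
    by (rule bounded_kernel_mult[OF bounded_kernel_transpose[OF *] bounded_kernel_cnj[OF *]])
qed

lemma bounded_kernel_final: "bounded_kernel M M (final_kernel i j)"
  unfolding final_kernel_def by (rule bounded_kernel_sum) (rule bounded_kernel_final_term)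

lemma dissipation_form:
  assumes f: "f \<in> L2 l"
  shows "(\<Sum>i\<in>UNIV. \<Sum>j\<in>UNIV. kernel_form M (dissipation_kernel i j) (\<lambda>t. f t $ j) (\<lambda>t. f t $ i)) =
    of_real (\<Sum>q\<in>UNIV. (LINT z|N. (norm (damping_output f q z))\<^sup>2) / d q)"
proof -
  define o' where "o' j q z = (LINT t|M. output_kernel j q z t * f t $ j)" for j q z
  have "kernel_form M (dissipation_kernel i j) (\<lambda>t. f t $ j) (\<lambda>t. f t $ i)
      = (\<Sum>q\<in>UNIV. (LINT z|N. o' j q z * cnj (o' i q z)) / d q)" for i j
  proof -
    have "kernel_form M (dissipation_kernel i j) (\<lambda>t. f t $ j) (\<lambda>t. f t $ i)
      = (\<Sum>q\<in>UNIV. kernel_form M (\<lambda>s t. LINT z|N. (output_kernel j q z t / d q) * cnj (output_kernel i q z s))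
          (\<lambda>t. f t $ j) (\<lambda>t. f t $ i))"
      unfolding dissipation_kernel_def
      by (intro kernel_form_sum sigma_M bounded_kernel_dissipation_term L2_integrable_nth f)
    also have "\<dots> = (\<Sum>q\<in>UNIV. LINT z|N. (LINT t|M. (output_kernel j q z t / d q) * f t $ j) * cnj (o' i q z))"
    proof (rule sum.cong[OF refl])
      fix q
      have "bounded_kernel N M (\<lambda>z t. (1 / d q) * output_kernel j q z t)"
        by (intro bounded_kernel_mult bounded_kernel_const bounded_kernel_output)
      then have "bounded_kernel N M (\<lambda>z t. output_kernel j q z t / d q)" by simp
      from kernel_form_factored[OF finite_N sigma_M this bounded_kernel_output
          L2_integrable_nth[OF f] L2_integrable_nth[OF f]]
      show "kernel_form M (\<lambda>s t. LINT z|N. (output_kernel j q z t / d q) * cnj (output_kernel i q z s))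
          (\<lambda>t. f t $ j) (\<lambda>t. f t $ i)
        = (LINT z|N. (LINT t|M. (output_kernel j q z t / d q) * f t $ j) * cnj (o' i q z))"
        unfolding o'_def .
    qed
    also have "\<dots> = (\<Sum>q\<in>UNIV. (LINT z|N. o' j q z * cnj (o' i q z)) / d q)"
      by (simp add: o'_def)
    finally show ?thesis .
  qed
  then have "(\<Sum>i\<in>UNIV. \<Sum>j\<in>UNIV. kernel_form M (dissipation_kernel i j) (\<lambda>t. f t $ j) (\<lambda>t. f t $ i))
      = (\<Sum>i\<in>UNIV. \<Sum>j\<in>UNIV. \<Sum>q\<in>UNIV. (LINT z|N. o' j q z * cnj (o' i q z)) / d q)"
    by simp
  also have "\<dots> = (\<Sum>q\<in>UNIV. \<Sum>i\<in>UNIV. \<Sum>j\<in>UNIV. (LINT z|N. o' j q z * cnj (o' i q z)) / d q)"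
    by (rule sum_rotate)
  also have "\<dots> = (\<Sum>q\<in>UNIV. of_real ((LINT z|N. (norm (damping_output f q z))\<^sup>2) / d q))"
  proof (rule sum.cong[OF refl])
    fix q
    have "of_real (LINT z|N. (norm (damping_output f q z))\<^sup>2) = (LINT z|N. of_real ((norm (damping_output f q z))\<^sup>2) :: complex)"
      by (rule integral_complex_of_real[symmetric])
    also have "\<dots> = (LINT z|N. (\<Sum>i\<in>UNIV. (\<Sum>j\<in>UNIV. o' j q z * cnj (o' i q z))))"
      unfolding output_square o'_def ..
    also have "\<dots> = (\<Sum>i\<in>UNIV. \<Sum>j\<in>UNIV. (LINT z|N. o' j q z * cnj (o' i q z)))"
      using integrable_output_product[OF f] unfolding o'_def by simp
    finally show "(\<Sum>i\<in>UNIV. \<Sum>j\<in>UNIV. (LINT z|N. o' j q z * cnj (o' i q z)) / d q)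
        = of_real ((LINT z|N. (norm (damping_output f q z))\<^sup>2) / d q)"
      by (simp only: of_real_divide sum_divide_distrib[symmetric])
  qed
  finally show ?thesis by simp
qed

lemma final_form:
  assumes f: "f \<in> L2 l"
  shows "(\<Sum>i\<in>UNIV. \<Sum>j\<in>UNIV. kernel_form M (final_kernel i j) (\<lambda>t. f t $ j) (\<lambda>t. f t $ i)) =
    of_real ((norm (final_state f))\<^sup>2)"
proof -
  define u where "u j r = (LINT t|M. a j (L - d j * t) $ r * f t $ j)" for j r
  have "kernel_form M (final_kernel i j) (\<lambda>t. f t $ j) (\<lambda>t. f t $ i) = (\<Sum>r\<in>UNIV. u j r * cnj (u i r))" for i j
    unfolding final_kernel_def u_def kernel_form_separable[symmetric]
    by (intro kernel_form_sum sigma_M bounded_kernel_final_term L2_integrable_nth f)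
  then have "(\<Sum>i\<in>UNIV. \<Sum>j\<in>UNIV. kernel_form M (final_kernel i j) (\<lambda>t. f t $ j) (\<lambda>t. f t $ i))
      = (\<Sum>i\<in>UNIV. \<Sum>j\<in>UNIV. \<Sum>r\<in>UNIV. u j r * cnj (u i r))" by simp
  also have "\<dots> = (\<Sum>r\<in>UNIV. (\<Sum>j\<in>UNIV. u j r) * cnj (\<Sum>i\<in>UNIV. u i r))"
    unfolding cnj_sum sum_product
    by (subst sum_rotate) (rule sum.cong[OF refl], rule sum.swap)
  also have "\<dots> = cinner (final_state f) (final_state f)"
    by (simp add: cinner_def final_state_def u_def)
  finally show ?thesis by (simp only: cinner_same)
qed

text \<open>
  The form of \<open>damped_kernel_decomposition\<close>. The decomposition fails only on the lines
  \<open>d i * s = d j * t\<close>, each of which meets every section in a null set.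
\<close>

theorem damped_form_identity:
  assumes f: "f \<in> L2 l"
  shows "L2_inner l (second_kind_op l (damped_kernel e) f) f = of_real (L2_sq l f +
    2 * Re (L2_inner l (V.K f) f) + (\<Sum>q\<in>UNIV. (LINT z|N. (norm (damping_output f q z))\<^sup>2) / d q) +
    (norm (final_state f))\<^sup>2)"
proof -
  interpret D: L2_kernel l "damped_kernel e" by (rule L2_kernel_damped)
  let ?\<phi> = "\<lambda>j t. f t $ j"
  note \<phi> = L2_integrable_nth[OF f]
  define v where "v i j = kernel_form M (\<lambda>s t. volterra_kernel s t $ i $ j) (?\<phi> j) (?\<phi> i)" for i j
  have adj: "bounded_kernel M M (\<lambda>s t. cnj (volterra_kernel t s $ j $ i))" for i j
    by (rule bounded_kernel_cnj[OF bounded_kernel_transpose[OF bounded_kernel_volterra]])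
  note bk = bounded_kernel_volterra adj bounded_kernel_dissipation bounded_kernel_final
  have split: "kernel_form M (\<lambda>s t. damped_kernel e s t $ i $ j) (?\<phi> j) (?\<phi> i) =
    v i j + cnj (v j i) + (kernel_form M (dissipation_kernel i j) (?\<phi> j) (?\<phi> i) +
    kernel_form M (final_kernel i j) (?\<phi> j) (?\<phi> i))" for i j
  proof -
    have "kernel_form M (\<lambda>s t. damped_kernel e s t $ i $ j) (?\<phi> j) (?\<phi> i) =
      kernel_form M (\<lambda>s t. volterra_kernel s t $ i $ j + cnj (volterra_kernel t s $ j $ i)
        + (dissipation_kernel i j s t + final_kernel i j s t)) (?\<phi> j) (?\<phi> i)"
    proof (rule kernel_form_cong_AE)
      fix s assume "s \<in> space M"
      then have s: "s \<in> {0<..<l}" by simp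
      have "AE t in M. t \<noteq> d i * s / d j"
      proof -
        have "AE t in lebesgue. t \<noteq> d i * s / d j"
          by (rule AE_I[where N="{d i * s / d j}"]) auto
        then have "AE t in lebesgue. t \<in> {0<..<l} \<longrightarrow> t \<noteq> d i * s / d j"
          by eventually_elim simp
        then show ?thesis by (simp add: AE_restrict_space_iff)
      qed
      moreover have "AE t in M. t \<in> {0<..<l}" by (rule AE_I2) simp
      ultimately show "AE t in M. damped_kernel e s t $ i $ j = volterra_kernel s t $ i $ j +
        cnj (volterra_kernel t s $ j $ i) + (dissipation_kernel i j s t + final_kernel i j s t)"
      proof eventually_elim
        case (elim t)
        then have "d i * s \<noteq> d j * t" using d_pos[of j] by auto
        then show ?case using damped_kernel_decomposition[OF s] elim by blast
      qed
    qed (intro bounded_kernel_damped bounded_kernel_add bk \<phi>)+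
    also have "\<dots> = v i j + kernel_form M (\<lambda>s t. cnj (volterra_kernel t s $ j $ i)) (?\<phi> j) (?\<phi> i) +
      (kernel_form M (dissipation_kernel i j) (?\<phi> j) (?\<phi> i) +
       kernel_form M (final_kernel i j) (?\<phi> j) (?\<phi> i))"
      unfolding v_def
      by (simp only: kernel_form_add[OF sigma_M _ _ \<phi> \<phi>] bounded_kernel_add bk)
    also have "kernel_form M (\<lambda>s t. cnj (volterra_kernel t s $ j $ i)) (?\<phi> j) (?\<phi> i) = cnj (v j i)"
      unfolding v_def by (rule kernel_form_adjoint[OF sigma_M bounded_kernel_volterra \<phi> \<phi>])
    finally show ?thesis .
  qed
  have V: "(\<Sum>i\<in>UNIV. \<Sum>j\<in>UNIV. v i j) = L2_inner l (V.K f) f"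
    unfolding v_def by (rule V.L2_inner_K[OF f, symmetric])
  have V': "(\<Sum>i\<in>UNIV. \<Sum>j\<in>UNIV. cnj (v j i)) = cnj (L2_inner l (V.K f) f)"
    unfolding V[symmetric] cnj_sum by (rule sum.swap)
  have "L2_inner l (D.K f) f = L2_inner l (V.K f) f + cnj (L2_inner l (V.K f) f) +
    (of_real (\<Sum>q\<in>UNIV. (LINT z|N. (norm (damping_output f q z))\<^sup>2) / d q) + of_real ((norm (final_state f))\<^sup>2))"
    unfolding D.L2_inner_K[OF f] split sum.distrib V V' dissipation_form[OF f] final_form[OF f] ..
  then show ?thesis
    unfolding D.L2_inner_S[OF f] complex_add_cnj by (simp only: of_real_add add.assoc)
qed

text \<open>
  Dropping the final energy, and the damping outputs outside \<open>(0, d q * l)\<close>, from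
  \<open>damped_form_identity\<close> leaves the complete square \<open>\<parallel>f + Vf\<parallel>\<^sup>2\<close>: the substitution \<open>z = d q * s\<close> turns
  the remaining part of the damping output \<open>q\<close> into the component \<open>q\<close> of \<open>Vf\<close>.
\<close>

lemma damped_form_ge_volterra:
  assumes f: "f \<in> L2 l"
  shows "L2_sq l (V.S f) \<le> Re (L2_inner l (second_kind_op l (damped_kernel e) f) f)"
proof -
  have "L2_sq l (V.K f) = (\<Sum>i\<in>UNIV. LINT s|M. (norm (damping_output f i (d i * s)))\<^sup>2)"
    unfolding L2_sq_components[OF V.K_L2[OF f]]
    by (intro sum.cong refl Bochner_Integration.integral_cong) (simp_all add: volterra_eq_output[OF f])
  also have "\<dots> \<le> (\<Sum>i\<in>UNIV. (LINT z|N. (norm (damping_output f i z))\<^sup>2) / d i)"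
    by (intro sum_mono integral_dilation_le integrable_output_square f d_pos d_le) simp
  finally show ?thesis
    unfolding damped_form_identity[OF f] V.L2_sq_S[OF f] Re_complex_of_real
    by (simp add: add_increasing2)
qed

end

section \<open>The Volterra operator is bounded below\<close>

lemma exp_integral_bound:
  fixes l D \<mu> y :: real
  assumes D: "0 < D" and \<mu>: "0 < \<mu>" and y: "0 \<le> y"
  shows "integrable (leb_on l) (\<lambda>t. if D * t \<le> y then exp (\<mu> * (D * t)) else 0)"
    and "(LINT t|leb_on l. (if D * t \<le> y then exp (\<mu> * (D * t)) else 0)) \<le> exp (\<mu> * y) / (\<mu> * D)"
proof -
  define e where "e t = exp (\<mu> * (D * t))" for t
  define E where "E t = indicator {0..y / D} t *\<^sub>R e t" for t
  have e_cont: "continuous_on A e" for A unfolding e_def by (intro continuous_intros)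
  have [measurable]: "e \<in> borel_measurable borel"
    by (intro borel_measurable_continuous_onI e_cont)
  have E_meas: "E \<in> borel_measurable lborel" unfolding E_def by measurable
  have E_int: "integrable lborel E"
    using borel_integrable_atLeastAtMost'[OF e_cont, of 0 "y / D"]
    unfolding set_integrable_def E_def .
  have "(LBINT t. E t) = e (y / D) / (\<mu> * D) - e 0 / (\<mu> * D)"
    unfolding E_def
  proof (rule integral_FTC_atLeastAtMost[OF _ _ e_cont])
    show "0 \<le> y / D" using y D by simp
    fix t
    have "((\<lambda>t. e t / (\<mu> * D)) has_real_derivative e t) (at t within {0..y / D})"
      unfolding e_def using D \<mu> by (auto intro!: derivative_eq_intros)
    then show "((\<lambda>t. e t / (\<mu> * D)) has_vector_derivative e t) (at t within {0..y / D})"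
      by (simp add: has_real_derivative_iff_has_vector_derivative)
  qed
  then have E_le: "(LINT t|lebesgue. E t) \<le> exp (\<mu> * y) / (\<mu> * D)"
    using D \<mu> integral_completion[OF E_meas] by (simp add: e_def)
  have E_int': "integrable lebesgue E"
    using E_int integrable_completion[OF E_meas] by simp
  define h where "h t = (if D * t \<le> y then e t else 0)" for t
  have [measurable]: "h \<in> borel_measurable borel" unfolding h_def by measurable
  have h: "indicator {0<..<l} t *\<^sub>R h t = indicator {0<..<l} t *\<^sub>R E t" for t
    using D by (auto simp: h_def E_def indicator_def field_simps)
  have ind: "integrable lebesgue (\<lambda>t. indicator {0<..<l} t *\<^sub>R E t)"
    by (intro integrable_mult_indicator E_int') auto
  then have "integrable lebesgue (\<lambda>t. indicator {0<..<l} t *\<^sub>R h t)" by (simp only: h)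
  then have "integrable (leb_on l) h" by (simp add: integrable_restrict_space)
  then show "integrable (leb_on l) (\<lambda>t. if D * t \<le> y then exp (\<mu> * (D * t)) else 0)"
    unfolding h_def e_def .
  have "(LINT t|leb_on l. h t) = (LINT t|lebesgue. indicator {0<..<l} t *\<^sub>R E t)"
    unfolding h[symmetric] by (rule integral_restrict_space) simp
  also have "\<dots> \<le> (LINT t|lebesgue. E t)"
  proof (rule integral_mono[OF ind E_int'])
    show "indicator {0<..<l} t *\<^sub>R E t \<le> E t" for t
      by (auto simp: E_def e_def indicator_def)
  qed
  finally show "(LINT t|leb_on l. (if D * t \<le> y then exp (\<mu> * (D * t)) else 0)) \<le> exp (\<mu> * y) / (\<mu> * D)"
    using E_le unfolding h_def e_def by linarith
qed

context damped_system
begin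

text \<open>
  A Gronwall argument in the time variable \<open>d i * s\<close>, which is common to all channels. With \<open>g = f + Vf\<close>
  and \<open>\<rho> = Vf\<close> one has \<open>\<rho> = V(g - \<rho>)\<close>. In the weighted supremum \<open>m\<close> of \<open>exp (-\<mu> d i s) \<bar>\<rho> s $ i\<bar>\<close> the
  operator \<open>V\<close> has norm at most \<open>1/2\<close> once \<open>\<mu>\<close> is large, so that \<open>m\<close> is bounded by \<open>g\<close> alone.
\<close>

lemma volterra_bound_by_S:
  obtains X where "0 \<le> X"
    "\<And>f s i. f \<in> L2 l \<Longrightarrow> s \<in> {0<..<l} \<Longrightarrow> norm (V.K f s $ i) \<le> X * L2_norm l (V.S f)"
proof -
  obtain B where B: "0 \<le> B"
    "\<And>i j s t. s \<in> {0<..<l} \<Longrightarrow> t \<in> {0<..<l} \<Longrightarrow> norm (volterra_kernel s t $ i $ j) \<le> B"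
    by (rule V.entry_bound) blast
  obtain M' where M': "\<And>f x. f \<in> L2 l \<Longrightarrow> x \<in> {0<..<l} \<Longrightarrow> norm (V.K f x) \<le> M' * L2_norm l f"
    by (rule V.K_bound) blast
  define p where "p = real CARD('p)"
  define D where "D = (\<Sum>j\<in>UNIV. 1 / d j)"
  define \<mu> where "\<mu> = 2 * B * D + 1"
  have D: "0 \<le> D" unfolding D_def by (intro sum_nonneg) (simp add: less_imp_le d_pos)
  have \<mu>: "0 < \<mu>" "B * D / \<mu> \<le> 1 / 2"
    using mult_nonneg_nonneg[OF B(1) D] by (auto simp: \<mu>_def field_simps)
  show ?thesis
  proof (rule that[of "exp (\<mu> * L) * (2 * (B * (p * sqrt l)))"])
    fix f :: "real \<Rightarrow> complex^'p" and s i assume f: "f \<in> L2 l" and s: "s \<in> {0<..<l}"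
    define g where "g = V.S f"
    define \<rho> where "\<rho> = V.K f"
    have g: "g \<in> L2 l" unfolding g_def by (rule V.S_L2[OF f])
    have f_eq: "f t = g t - \<rho> t" for t by (simp add: g_def \<rho>_def V.S_eq)
    define w where "w i s = exp (- (\<mu> * (d i * s))) * norm (\<rho> s $ i)" for i s
    define A where "A = (\<lambda>(i, s). w i s) ` (UNIV \<times> {0<..<l})"
    define m where "m = Sup A"
    have w_in: "w i s \<in> A" if "s \<in> {0<..<l}" for i s using that unfolding A_def by auto
    have "w i s \<le> M' * L2_norm l f" if s: "s \<in> {0<..<l}" for i s
    proof -
      have "0 \<le> \<mu> * (d i * s)" using \<mu>(1) dt_range[OF s, of i] by simp
      then have "w i s \<le> 1 * norm (\<rho> s $ i)" unfolding w_def by (intro mult_right_mono) auto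
      also have "\<dots> \<le> norm (\<rho> s)" by (simp add: Finite_Cartesian_Product.norm_nth_le)
      also have "\<dots> \<le> M' * L2_norm l f" unfolding \<rho>_def by (rule M'[OF f s])
      finally show ?thesis .
    qed
    then have bdd: "bdd_above A" unfolding A_def by (intro bdd_aboveI[of _ "M' * L2_norm l f"]) auto
    have w_le: "w i s \<le> m" if "s \<in> {0<..<l}" for i s
      unfolding m_def by (rule cSup_upper[OF w_in[OF that] bdd])
    have m0: "0 \<le> m" using w_le[OF s, of i] by (rule order_trans[rotated]) (simp add: w_def)
    have \<rho>_le: "norm (\<rho> t $ j) \<le> m * exp (\<mu> * (d j * t))" if t: "t \<in> {0<..<l}" for j t
    proof -
      have "norm (\<rho> t $ j) = w j t * exp (\<mu> * (d j * t))"
        by (simp add: w_def exp_minus)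
      then show ?thesis using w_le[OF t, of j] by (simp add: mult_right_mono)
    qed
    have w_step: "w i s \<le> B * (p * (sqrt l * L2_norm l g)) + m / 2" if s: "s \<in> {0<..<l}" for i s
    proof -
      define y where "y = d i * s"
      have y: "0 \<le> y" using dt_range[OF s, of i] by (simp add: y_def)
      define E where "E j t = (if d j * t \<le> y then exp (\<mu> * (d j * t)) else 0)" for j t
      have E: "integrable M (E j)" "(LINT t|M. E j t) \<le> exp (\<mu> * y) / (\<mu> * d j)" for j
        unfolding E_def by (rule exp_integral_bound[OF d_pos \<mu>(1) y])+
      have entry: "norm (LINT t|M. volterra_kernel s t $ i $ j * f t $ j)
          \<le> B * (sqrt l * L2_norm l g) + B * m * (exp (\<mu> * y) / (\<mu> * d j))" for j
      proof -
        have "norm (LINT t|M. volterra_kernel s t $ i $ j * f t $ j)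
            \<le> (LINT t|M. norm (volterra_kernel s t $ i $ j * f t $ j))" by (rule integral_norm_bound)
        also have "\<dots> \<le> (LINT t|M. B * norm (g t) + B * m * E j t)"
        proof (rule integral_mono)
          show "integrable M (\<lambda>t. norm (volterra_kernel s t $ i $ j * f t $ j))"
            by (rule integrable_norm[OF V.integrable_entry[OF f s]])
          show "integrable M (\<lambda>t. B * norm (g t) + B * m * E j t)"
            using L2_integrable_norm[OF g] E(1) by simp
          fix t assume "t \<in> space M"
          then have t: "t \<in> {0<..<l}" by simp
          show "norm (volterra_kernel s t $ i $ j * f t $ j) \<le> B * norm (g t) + B * m * E j t"
          proof (cases "d j * t \<le> y")
            case True
            have "norm (f t $ j) \<le> norm (g t $ j) + norm (\<rho> t $ j)"
              unfolding f_eq vector_minus_component by (rule norm_triangle_ineq4)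
            also have "\<dots> \<le> norm (g t) + m * E j t"
              using \<rho>_le[OF t, of j] True
              by (intro add_mono Finite_Cartesian_Product.norm_nth_le) (simp add: E_def)
            finally have "norm (volterra_kernel s t $ i $ j) * norm (f t $ j) \<le> B * (norm (g t) + m * E j t)"
              by (intro mult_mono B s t) auto
            then show ?thesis by (simp add: norm_mult distrib_left mult.assoc)
          next
            case False
            then have "volterra_kernel s t $ i $ j = 0"
              by (simp add: volterra_kernel_def output_kernel_def y_def)
            then show ?thesis using B(1) m0 by (simp add: E_def)
          qed
        qed
        also have "\<dots> = B * (LINT t|M. norm (g t)) + B * m * (LINT t|M. E j t)"
          using L2_integrable_norm[OF g] E(1) by simp
        also have "\<dots> \<le> B * (sqrt l * L2_norm l g) + B * m * (exp (\<mu> * y) / (\<mu> * d j))"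
          using B(1) m0 by (intro add_mono mult_left_mono E L2_integral_norm_le[OF l_pos g]) auto
        finally show ?thesis .
      qed
      have "norm (\<rho> s $ i) \<le> (\<Sum>j\<in>UNIV. norm (LINT t|M. volterra_kernel s t $ i $ j * f t $ j))"
        unfolding \<rho>_def V.K_nth[OF f s] by (rule norm_sum)
      also have "\<dots> \<le> (\<Sum>j\<in>UNIV. B * (sqrt l * L2_norm l g) + B * m * (exp (\<mu> * y) / (\<mu> * d j)))"
        by (intro sum_mono entry)
      also have "\<dots> = B * (p * (sqrt l * L2_norm l g)) + (m * exp (\<mu> * y)) * (B * D / \<mu>)"
        by (simp add: sum.distrib p_def D_def sum_distrib_left sum_divide_distrib mult_ac)
      also have "\<dots> \<le> B * (p * (sqrt l * L2_norm l g)) + (m * exp (\<mu> * y)) * (1 / 2)"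
        using m0 by (intro add_left_mono mult_left_mono \<mu>(2)) auto
      finally have "w i s \<le> exp (- (\<mu> * y)) * (B * (p * (sqrt l * L2_norm l g)) + (m * exp (\<mu> * y)) * (1 / 2))"
        unfolding w_def y_def[symmetric] by (intro mult_left_mono) auto
      also have "\<dots> = exp (- (\<mu> * y)) * (B * (p * (sqrt l * L2_norm l g))) + m / 2"
        by (simp add: distrib_left exp_minus)
      also have "\<dots> \<le> 1 * (B * (p * (sqrt l * L2_norm l g))) + m / 2"
        using \<mu>(1) y B(1) l_pos by (intro add_right_mono mult_right_mono) (auto simp: p_def L2_norm_sqrt)
      finally show ?thesis by simp
    qed
    have "m \<le> B * (p * (sqrt l * L2_norm l g)) + m / 2"
      unfolding m_def by (rule cSup_least) (use w_in[OF s] w_step in \<open>auto simp: A_def m_def\<close>)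
    then have m: "m \<le> 2 * (B * (p * sqrt l)) * L2_norm l g" by simp
    have "norm (\<rho> s $ i) \<le> m * exp (\<mu> * (d i * s))" by (rule \<rho>_le[OF s])
    also have "\<dots> \<le> m * exp (\<mu> * L)"
      using m0 \<mu>(1) dt_range[OF s, of i] by (intro mult_left_mono) auto
    also have "\<dots> \<le> (2 * (B * (p * sqrt l)) * L2_norm l g) * exp (\<mu> * L)"
      by (intro mult_right_mono m) simp
    finally show "norm (V.K f s $ i) \<le> exp (\<mu> * L) * (2 * (B * (p * sqrt l))) * L2_norm l (V.S f)"
      unfolding \<rho>_def g_def by (simp only: mult_ac)
  qed (use B(1) l_pos in \<open>simp add: p_def\<close>)
qed

lemma volterra_lower_bound:
  obtains C where "0 < C" "\<And>f. f \<in> L2 l \<Longrightarrow> L2_sq l f \<le> C * L2_sq l (V.S f)"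
proof -
  interpret finite_measure M by (rule finite_measure_leb_on)
  obtain X where X: "0 \<le> X"
    "\<And>f s i. f \<in> L2 l \<Longrightarrow> s \<in> {0<..<l} \<Longrightarrow> norm (V.K f s $ i) \<le> X * L2_norm l (V.S f)"
    by (rule volterra_bound_by_S) blast
  define p where "p = real CARD('p)"
  show ?thesis
  proof (rule that[of "2 + 2 * (l * (p * X)\<^sup>2)"])
    fix f :: "real \<Rightarrow> complex^'p" assume f: "f \<in> L2 l"
    have K: "norm (V.K f s) \<le> p * X * L2_norm l (V.S f)" if "s \<in> {0<..<l}" for s
    proof -
      have "(\<Sum>i\<in>UNIV. norm (V.K f s $ i)) \<le> p * (X * L2_norm l (V.S f))"
        unfolding p_def by (rule sum_bounded_above) (rule X(2)[OF f that])
      then show ?thesis using complex_vec_norm_le[of "V.K f s"] by (simp add: mult.assoc)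
    qed
    have "L2_sq l (V.K f) \<le> (LINT x|M. (p * X * L2_norm l (V.S f))\<^sup>2)"
      by (rule L2_bound(2)) (auto intro!: power_mono K L2_measurable V.K_L2 f)
    also have "\<dots> = l * (p * X)\<^sup>2 * L2_sq l (V.S f)"
      using l_pos by (simp add: measure_leb_on power_mult_distrib L2_norm_sqrt)
    finally have K': "L2_sq l (V.K f) \<le> l * (p * X)\<^sup>2 * L2_sq l (V.S f)" .
    have "L2_sq l (\<lambda>x. V.S f x + (-1) *\<^sub>R V.K f x) \<le> 2 * L2_sq l (V.S f) + 2 * L2_sq l (\<lambda>x. (-1) *\<^sub>R V.K f x)"
      by (rule L2_add(2)[OF V.S_L2[OF f] L2_scaleR[OF V.K_L2[OF f]]])
    moreover have "(\<lambda>x. V.S f x + (-1) *\<^sub>R V.K f x) = f" by (simp add: V.S_eq fun_eq_iff)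
    ultimately have "L2_sq l f \<le> 2 * L2_sq l (V.S f) + 2 * L2_sq l (V.K f)"
      by (simp only: L2_sq_scaleR) simp
    with K' show "L2_sq l f \<le> (2 + 2 * (l * (p * X)\<^sup>2)) * L2_sq l (V.S f)"
      by (simp add: algebra_simps)
  qed (use l_pos in \<open>simp add: add_pos_nonneg\<close>)
qed

text \<open>
  Combining \<open>damped_form_ge_volterra\<close> with the lower bound for the Volterra operator makes \<open>S\<close> coercive.
  The kernel is only required to agree with \<open>damped_kernel e\<close> on the square, since the values of
  \<open>D_difference_kernel d k\<close> elsewhere are arbitrary.
\<close>

theorem damped_operator_properties:
  fixes \<kappa> :: "real \<Rightarrow> real \<Rightarrow> complex^'p^'p"
  assumes \<kappa>: "\<And>s t. s \<in> {0<..<l} \<Longrightarrow> t \<in> {0<..<l} \<Longrightarrow> \<kappa> s t = damped_kernel e s t"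
  shows "bounded_operator_L2 l (second_kind_op l \<kappa>)"
    and "positive_operator_L2 l (second_kind_op l \<kappa>)"
    and "boundedly_invertible_L2 l (second_kind_op l \<kappa>)"
proof -
  interpret D: L2_kernel l \<kappa>
  proof
    show "bounded_kernel M M (\<lambda>x t. \<kappa> x t $ i $ j)" for i j
      by (rule bounded_kernel_cong[OF bounded_kernel_damped[of e i j]]) (simp add: \<kappa>)
  qed (rule l_pos)
  show "bounded_operator_L2 l D.S" by (rule D.bounded_operator_S)
  have inner: "L2_inner l (D.S f) f = L2_inner l (second_kind_op l (damped_kernel e) f) f" for f
  proof -
    have "(LINT t|M. \<kappa> s t *v f t) = (LINT t|M. damped_kernel e s t *v f t)" if "s \<in> {0<..<l}" for s
      using that by (intro Bochner_Integration.integral_cong) (simp_all add: \<kappa>)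
    then show ?thesis
      unfolding L2_inner_def second_kind_op_def by (intro Bochner_Integration.integral_cong) simp_all
  qed
  obtain C where C: "0 < C" "\<And>f. f \<in> L2 l \<Longrightarrow> L2_sq l f \<le> C * L2_sq l (V.S f)"
    by (rule volterra_lower_bound) blast
  have coercive: "(1 / C) * L2_sq l f \<le> Re (L2_inner l (D.S f) f)" if f: "f \<in> L2 l" for f
  proof -
    have "C * L2_sq l (V.S f) \<le> C * Re (L2_inner l (D.S f) f)"
      unfolding inner using C(1) by (intro mult_left_mono damped_form_ge_volterra f) simp
    with C(2)[OF f] have "L2_sq l f \<le> C * Re (L2_inner l (D.S f) f)" by linarith
    then show ?thesis using C(1) by (simp add: pos_divide_le_eq mult.commute)
  qed
  interpret D: coercive_kernel l \<kappa> "1 / C"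
    by unfold_locales (use C(1) coercive in auto)
  show "boundedly_invertible_L2 l D.S" by (rule D.boundedly_invertible_S)
  show "positive_operator_L2 l D.S"
    unfolding positive_operator_L2_def
  proof (intro ballI impI conjI)
    fix f :: "real \<Rightarrow> complex^'p" assume f: "f \<in> L2 l" and "\<not> L2_eq l f (\<lambda>x. 0)"
    then have "0 < L2_sq l f" using L2_sq_eq_0[OF f] L2_sq_nonneg[of l f] by linarith
    then have "0 < (1 / C) * L2_sq l f" using C(1) by simp
    then show "0 < Re (L2_inner l (D.S f) f)" using coercive[OF f] by linarith
    show "L2_inner l (D.S f) f \<in> \<real>"
      unfolding inner damped_form_identity[OF f] by (rule Reals_of_real)
  qed
qed

end

section \<open>The matrix exponential\<close>

lemma matrix_mult_nth: "(A ** B) $ i $ j = (\<Sum>k\<in>UNIV. A $ i $ k * B $ k $ j)"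
  by (simp add: matrix_matrix_mult_def)

lemma matrix_power_Suc: "matrix_power A (Suc m) = A ** matrix_power A m"
  by (simp add: matrix_power_def)

lemma matrix_power_cscale: "matrix_power (cscale c A) m = cscale (c ^ m) (matrix_power A m)"
proof (induction m)
  case 0
  show ?case by (simp add: matrix_power_def cscale_def map_matrix_def vec_eq_iff)
next
  case (Suc m)
  then show ?case
    by (simp add: matrix_power_Suc vec_eq_iff matrix_mult_nth cscale_def map_matrix_def
        sum_distrib_left mult_ac)
qed

lemma matrix_power_entry_bound:
  "norm (matrix_power A m $ i $ j) \<le> (\<Sum>i\<in>UNIV. \<Sum>k\<in>UNIV. norm (A $ i $ k)) ^ m"
proof (induction m arbitrary: i)
  case 0
  show ?case by (simp add: matrix_power_def mat_def)
next
  case (Suc m)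
  let ?r = "\<Sum>i\<in>UNIV. \<Sum>k\<in>UNIV. norm (A $ i $ k)"
  have r: "0 \<le> ?r" by (intro sum_nonneg) simp
  have "norm (matrix_power A (Suc m) $ i $ j) \<le> (\<Sum>k\<in>UNIV. norm (A $ i $ k) * ?r ^ m)"
    unfolding matrix_power_Suc matrix_mult_nth
    by (rule order_trans[OF norm_sum sum_mono]) (simp add: norm_mult mult_left_mono Suc)
  also have "\<dots> = (\<Sum>k\<in>UNIV. norm (A $ i $ k)) * ?r ^ m" by (simp add: sum_distrib_right)
  also have "\<dots> \<le> ?r * ?r ^ m"
  proof (intro mult_right_mono)
    show "(\<Sum>k\<in>UNIV. norm (A $ i $ k)) \<le> ?r"
      by (rule member_le_sum[of i UNIV "\<lambda>i. \<Sum>k\<in>UNIV. norm (A $ i $ k)"]) (auto intro: sum_nonneg)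
  qed (use r in simp)
  finally show ?case by simp
qed

text \<open>
  The entries of \<open>matrix_exp (cscale c A)\<close> are everywhere convergent power series in the complex
  number \<open>c\<close>, which reduces the differentiation of the matrix exponential to that of power series.
\<close>

definition exp_coeff :: "complex^'n^'n \<Rightarrow> 'n \<Rightarrow> 'n \<Rightarrow> nat \<Rightarrow> complex" where
  "exp_coeff A i j m = matrix_power A m $ i $ j / fact m"

lemma summable_exp_coeff: "summable (\<lambda>m. exp_coeff A i j m * c ^ m)"
proof (rule summable_norm_cancel, rule summable_comparison_test)
  let ?r = "\<Sum>i\<in>UNIV. \<Sum>k\<in>UNIV. norm (A $ i $ k)"
  show "summable (\<lambda>m. inverse (fact m) * (?r * norm c) ^ m)" by (rule summable_exp)
  show "\<exists>N. \<forall>m\<ge>N. norm (norm (exp_coeff A i j m * c ^ m)) \<le> inverse (fact m) * (?r * norm c) ^ m"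
  proof (intro exI allI impI)
    fix m
    have "norm (matrix_power A m $ i $ j) * norm c ^ m \<le> ?r ^ m * norm c ^ m"
      by (intro mult_right_mono matrix_power_entry_bound) simp
    then show "norm (norm (exp_coeff A i j m * c ^ m)) \<le> inverse (fact m) * (?r * norm c) ^ m"
      by (simp add: exp_coeff_def norm_mult norm_divide norm_power power_mult_distrib divide_simps)
  qed
qed

lemma sums_vec:
  assumes "\<And>i. (\<lambda>m. f m $ i) sums (s $ i)"
  shows "f sums s"
  using assms unfolding sums_def by (intro vec_tendstoI) (simp add: sum_component)

lemma matrix_exp_entry:
  fixes A :: "complex^'n^'n"
  shows "matrix_exp (cscale c A) $ i $ j = (\<Sum>m. exp_coeff A i j m * c ^ m)"
proof -
  define s :: "complex^'n^'n" where "s = (\<chi> i j. \<Sum>m. exp_coeff A i j m * c ^ m)"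
  have entry: "((1 / fact m :: real) *\<^sub>R matrix_power (cscale c A) m) $ i $ j = exp_coeff A i j m * c ^ m" for i j m
    unfolding matrix_power_cscale vector_scaleR_component
    by (simp add: cscale_def map_matrix_def exp_coeff_def scaleR_conv_of_real)
  have "(\<lambda>m. (1 / fact m :: real) *\<^sub>R matrix_power (cscale c A) m) sums s"
  proof (intro sums_vec)
    fix i j
    show "(\<lambda>m. ((1 / fact m :: real) *\<^sub>R matrix_power (cscale c A) m) $ i $ j) sums (s $ i $ j)"
      unfolding entry s_def vec_lambda_beta by (rule summable_sums[OF summable_exp_coeff])
  qed
  then have "matrix_exp (cscale c A) = s"
    unfolding matrix_exp_def by (rule sums_unique[symmetric])
  then show ?thesis by (simp add: s_def)
qed

lemma matrix_exp_zero: "matrix_exp (cscale 0 A) = mat 1"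
proof -
  have "matrix_exp (cscale 0 A) $ i $ j = mat 1 $ i $ j" for i j
    unfolding matrix_exp_entry
    using powser_zero[of "exp_coeff A i j"] by (simp add: exp_coeff_def matrix_power_def)
  then show ?thesis by (simp add: vec_eq_iff)
qed

lemma matrix_exp_entry_deriv:
  "((\<lambda>c. matrix_exp (cscale c A) $ i $ j) has_field_derivative
     (A ** matrix_exp (cscale c A)) $ i $ j) (at c)"
proof -
  have cancel: "of_nat (Suc m) * (x / fact (Suc m)) = x / fact m" for x :: complex and m
    by (simp add: fact_Suc del: of_nat_Suc)
  have "diffs (exp_coeff A i j) m = (\<Sum>k\<in>UNIV. A $ i $ k * exp_coeff A k j m)" for m
    unfolding diffs_def exp_coeff_def cancel
    by (simp add: matrix_power_Suc matrix_mult_nth sum_divide_distrib)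
  then have "(\<Sum>m. diffs (exp_coeff A i j) m * c ^ m)
      = (\<Sum>m. (\<Sum>k\<in>UNIV. A $ i $ k * (exp_coeff A k j m * c ^ m)))"
    by (simp add: sum_distrib_right mult.assoc)
  also have "\<dots> = (\<Sum>k\<in>UNIV. \<Sum>m. A $ i $ k * (exp_coeff A k j m * c ^ m))"
    by (intro suminf_sum summable_mult summable_exp_coeff)
  also have "\<dots> = (A ** matrix_exp (cscale c A)) $ i $ j"
    unfolding matrix_mult_nth matrix_exp_entry by (simp add: suminf_mult summable_exp_coeff)
  finally show ?thesis
    unfolding matrix_exp_entry
    using termdiffs_strong_converges_everywhere[OF summable_exp_coeff, of A i j c] by simp
qed

lemma has_vector_derivative_vec:
  fixes f :: "real \<Rightarrow> complex^'n"
  assumes "\<And>i. ((\<lambda>x. f x $ i) has_vector_derivative f' $ i) (at x)"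
  shows "(f has_vector_derivative f') (at x)"
proof -
  have lin: "bounded_linear (axis i :: complex \<Rightarrow> complex^'n)" for i
    by (rule linear_conv_bounded_linear[THEN iffD1]) (auto simp: linear_iff vec_eq_iff axis_def)
  have eq: "(\<Sum>i\<in>UNIV. axis i (v $ i)) = v" for v :: "complex^'n"
    by (simp add: vec_eq_iff axis_def if_distrib cong: if_cong)
  have "((\<lambda>x. \<Sum>i\<in>UNIV. axis i (f x $ i)) has_vector_derivative (\<Sum>i\<in>UNIV. axis i (f' $ i))) (at x)"
    by (intro has_vector_derivative_sum bounded_linear.has_vector_derivative[OF lin] assms)
  then show ?thesis unfolding eq .
qed

lemma matrix_exp_orbit_deriv:
  "((\<lambda>x. matrix_exp (cscale (\<i> * complex_of_real x) A) *v v) has_vector_derivative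
     cscale \<i> A *v (matrix_exp (cscale (\<i> * complex_of_real y) A) *v v)) (at y)"
proof (rule has_vector_derivative_vec)
  fix i
  have line: "((\<lambda>x. \<i> * complex_of_real x) has_vector_derivative \<i>) (at y)"
    using has_vector_derivative_mult_right[OF has_vector_derivative_of_real[OF DERIV_ident[of "at y"]], of \<i>]
    by simp
  have entry: "((\<lambda>x. matrix_exp (cscale (\<i> * complex_of_real x) A) $ i $ j) has_vector_derivative
      \<i> * (A ** matrix_exp (cscale (\<i> * complex_of_real y) A)) $ i $ j) (at y)" for j
    using field_vector_diff_chain_at[OF line matrix_exp_entry_deriv[of A i j]] by (simp add: o_def)
  have "((\<lambda>x. \<Sum>j\<in>UNIV. matrix_exp (cscale (\<i> * complex_of_real x) A) $ i $ j * v $ j) has_vector_derivative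
      (\<Sum>j\<in>UNIV. (\<i> * (A ** matrix_exp (cscale (\<i> * complex_of_real y) A)) $ i $ j) * v $ j)) (at y)"
    by (intro has_vector_derivative_sum has_vector_derivative_mult_left entry)
  also have "(\<Sum>j\<in>UNIV. (\<i> * (A ** matrix_exp (cscale (\<i> * complex_of_real y) A)) $ i $ j) * v $ j)
      = (cscale \<i> A *v (matrix_exp (cscale (\<i> * complex_of_real y) A) *v v)) $ i"
    unfolding matrix_vector_mul_assoc
    by (simp add: matrix_vector_mult_def matrix_mult_nth cscale_def map_matrix_def sum_distrib_left mult.assoc)
  finally show "((\<lambda>x. (matrix_exp (cscale (\<i> * complex_of_real x) A) *v v) $ i) has_vector_derivative
      (cscale \<i> A *v (matrix_exp (cscale (\<i> * complex_of_real y) A) *v v)) $ i) (at y)"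
    by (simp add: matrix_vector_mult_def)
qed

lemma conj_transpose_nth: "conj_transpose A $ i $ j = cnj (A $ j $ i)"
  by (simp add: conj_transpose_def map_matrix_def transpose_def)

lemma cinner_adjoint: "cinner (A *v u) v = cinner u (conj_transpose A *v v)"
proof -
  have "cinner (A *v u) v = (\<Sum>i\<in>UNIV. \<Sum>j\<in>UNIV. A $ i $ j * u $ j * cnj (v $ i))"
    by (simp add: cinner_def matrix_vector_mult_def sum_distrib_right)
  also have "\<dots> = (\<Sum>j\<in>UNIV. \<Sum>i\<in>UNIV. A $ i $ j * u $ j * cnj (v $ i))" by (rule sum.swap)
  also have "\<dots> = cinner u (conj_transpose A *v v)"
    by (simp add: cinner_def matrix_vector_mult_def sum_distrib_left conj_transpose_nth mult_ac)
  finally show ?thesis .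
qed

lemma conj_transpose_mult_nth: "(conj_transpose A *v v) $ i = cinner v (column i A)"
  by (simp add: matrix_vector_mult_def conj_transpose_nth cinner_def column_def mult.commute)

lemma matrix_inv_diag_matrix:
  assumes "\<And>i. d i \<noteq> 0"
  shows "matrix_inv (diag_matrix d) = diag_matrix (\<lambda>i. 1 / d i)"
proof -
  have entry: "(diag_matrix a ** diag_matrix b) = diag_matrix (\<lambda>i. a i * b i)" for a b :: "'a \<Rightarrow> real"
    by (simp add: vec_eq_iff matrix_mult_nth diag_matrix_def if_distrib[of "\<lambda>z. z * _"] cong: if_cong)
  have one: "diag_matrix (\<lambda>i. 1) = mat 1"
    by (simp add: vec_eq_iff diag_matrix_def mat_def)
  have inv: "diag_matrix d ** diag_matrix (\<lambda>i. 1 / d i) = mat 1"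
    "diag_matrix (\<lambda>i. 1 / d i) ** diag_matrix d = mat 1"
    using assms by (simp_all add: entry one)
  have "diag_matrix d ** matrix_inv (diag_matrix d) = mat 1"
    unfolding matrix_inv_def by (rule someI2[of _ "diag_matrix (\<lambda>i. 1 / d i)"]) (use inv in auto)
  then have "diag_matrix (\<lambda>i. 1 / d i) ** (diag_matrix d ** matrix_inv (diag_matrix d))
      = diag_matrix (\<lambda>i. 1 / d i)" by simp
  then show ?thesis by (simp add: matrix_mul_assoc inv)
qed

text \<open>
  The hypothesis on \<open>\<beta>\<close> says that the imaginary part of \<open>\<beta>\<^sup>*\<close> is \<open>\<Delta> D\<^sup>-\<^sup>1 \<Delta>\<^sup>*\<close> up to a factor, and
  therefore that \<open>exp (i x \<beta>\<^sup>*)\<close> is damped by the columns of \<open>\<Delta>\<close>.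
\<close>

lemma dissipation_identity:
  fixes \<Delta> :: "complex^'p^'n" and \<beta> :: "complex^'n^'n" and d :: "'p \<Rightarrow> real"
  assumes d: "\<And>i. d i \<noteq> 0"
    and \<beta>: "conj_transpose \<beta> - \<beta> =
      cscale \<i> (\<Delta> ** matrix_inv (diag_matrix d) ** conj_transpose \<Delta>)"
  shows "cinner (cscale \<i> (conj_transpose \<beta>) *v u) v + cinner u (cscale \<i> (conj_transpose \<beta>) *v v) =
    - (\<Sum>q\<in>UNIV. cinner u (column q \<Delta>) * cnj (cinner v (column q \<Delta>)) / d q)"
proof -
  define X where "X = \<Delta> ** matrix_inv (diag_matrix d) ** conj_transpose \<Delta>"
  have scale: "cscale c A *v w = c *s (A *v w)" for c w and A :: "complex^'n^'n"
    by (simp add: vec_eq_iff matrix_vector_mult_def cscale_def map_matrix_def sum_distrib_left mult.assoc)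
  have left: "cinner (c *s a) b = c * cinner a b" for c and a b :: "complex^'n"
    by (simp add: cinner_def sum_distrib_left mult.assoc)
  have right: "cinner a (c *s b) = cnj c * cinner a b" for c and a b :: "complex^'n"
    by (simp add: cinner_def sum_distrib_left mult_ac)
  have "cinner u (conj_transpose \<beta> *v v) = cinner (\<beta> *v u) v" by (rule cinner_adjoint[symmetric])
  then have "cinner (cscale \<i> (conj_transpose \<beta>) *v u) v + cinner u (cscale \<i> (conj_transpose \<beta>) *v v)
      = \<i> * (cinner (conj_transpose \<beta> *v u) v - cinner (\<beta> *v u) v)"
    by (simp add: scale left right algebra_simps)
  also have "cinner (conj_transpose \<beta> *v u) v = cinner ((\<beta> + cscale \<i> X) *v u) v"
    using \<beta> unfolding X_def[symmetric] by (simp add: algebra_simps)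
  also have "\<dots> = cinner (\<beta> *v u) v + \<i> * cinner (X *v u) v"
    by (simp add: matrix_vector_mult_add_rdistrib cinner_add_left scale left)
  finally have "cinner (cscale \<i> (conj_transpose \<beta>) *v u) v + cinner u (cscale \<i> (conj_transpose \<beta>) *v v)
      = - cinner (X *v u) v" by (simp add: algebra_simps)
  also have "cinner (X *v u) v = cinner (\<Delta> *v (diag_matrix (\<lambda>q. 1 / d q) *v (conj_transpose \<Delta> *v u))) v"
    by (simp add: X_def matrix_inv_diag_matrix[OF d] matrix_vector_mul_assoc matrix_mul_assoc)
  also have "\<dots> = cinner (diag_matrix (\<lambda>q. 1 / d q) *v (conj_transpose \<Delta> *v u)) (conj_transpose \<Delta> *v v)"
    by (rule cinner_adjoint)
  also have "\<dots> = (\<Sum>q\<in>UNIV. cinner u (column q \<Delta>) * cnj (cinner v (column q \<Delta>)) / d q)"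
  proof -
    have "(diag_matrix (\<lambda>q. 1 / d q) *v w) $ q = w $ q / d q" for w :: "complex^'p" and q
      by (simp add: matrix_vector_mult_def diag_matrix_def if_distrib[of "\<lambda>z. z * _"] cong: if_cong)
    then show ?thesis by (simp add: cinner_def[of "diag_matrix _ *v _"] conj_transpose_mult_nth)
  qed
  finally show ?thesis .
qed

section \<open>Positivity and bounded invertibility of S\<close>

text \<open>
  The trajectories are \<open>a i y = exp (i y \<beta>\<^sup>*) \<Theta>\<^sub>1 e\<^sub>i\<close> and the damping vectors are the columns of
  \<open>\<Theta>\<^sub>2 - \<Theta>\<^sub>1\<close>; the horizon is \<open>L = d\<^sub>1 l\<close>, where \<open>d\<^sub>1\<close> is the largest of the \<open>d i\<close>.
\<close>

theorem theorem4p3: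
  fixes \<Theta>\<^sub>1 \<Theta>\<^sub>2 :: "complex^'p::{finite,linorder}^'n"
    and \<beta> :: "complex^'n^'n"
    and d :: "'p::{finite,linorder} \<Rightarrow> real"
    and l :: real
    and k :: "real \<Rightarrow> complex^'p::{finite,linorder}^'p::{finite,linorder}"
  assumes d_decreasing: "\<And>i j. i \<le> j \<Longrightarrow> d j \<le> d i"
    and d_positive: "\<And>i. 0 < d i"
    and beta: "conj_transpose \<beta> - \<beta> =
      cscale \<i> ((\<Theta>\<^sub>2 - \<Theta>\<^sub>1) ** matrix_inv (diag_matrix d) ** conj_transpose (\<Theta>\<^sub>2 - \<Theta>\<^sub>1))"
    and l_positive: "0 < l"
    and k_pos: "\<And>x. 0 < x \<Longrightarrow> x < d (Min UNIV) * l \<Longrightarrow>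
      k x = conj_transpose \<Theta>\<^sub>2 ** matrix_exp (cscale (\<i> * complex_of_real x) (conj_transpose \<beta>)) ** \<Theta>\<^sub>1"
    and k_neg: "\<And>x. 0 < x \<Longrightarrow> x < d (Min UNIV) * l \<Longrightarrow> k (- x) = conj_transpose (k x)"
  shows "bounded_operator_L2 l (S_operator l d k) \<and>
    positive_operator_L2 l (S_operator l d k) \<and>
    boundedly_invertible_L2 l (S_operator l d k)"
proof -
  define L where "L = d (Min UNIV) * l"
  define E where "E y = matrix_exp (cscale (\<i> * complex_of_real y) (conj_transpose \<beta>))" for y
  define a where "a i y = E y *v column i \<Theta>\<^sub>1" for i y
  define a' where "a' i y = cscale \<i> (conj_transpose \<beta>) *v a i y" for i y
  define \<delta> where "\<delta> i = column i (\<Theta>\<^sub>2 - \<Theta>\<^sub>1)" for i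
  interpret damped_system d l L a a' \<delta>
  proof
    show "d i * l \<le> L" for i
      unfolding L_def using d_decreasing[of "Min UNIV" i] l_positive by (intro mult_right_mono) auto
    show "(a i has_vector_derivative a' i y) (at y)" for i y
      unfolding a_def a'_def E_def by (rule matrix_exp_orbit_deriv)
    show "cinner (a' i x) (a j y) + cinner (a i x) (a' j y) =
        - (\<Sum>q\<in>UNIV. cinner (a i x) (\<delta> q) * cnj (cinner (a j y) (\<delta> q)) / d q)" for i j x y
      unfolding a'_def \<delta>_def using d_positive
      by (intro dissipation_identity beta) (simp add: less_imp_neq[THEN not_sym])
  qed (fact l_positive d_positive)+
  have "E 0 = mat 1" unfolding E_def using matrix_exp_zero by simp
  then have "a i 0 = column i \<Theta>\<^sub>1" for i by (simp add: a_def)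
  then have column_2: "a i 0 + \<delta> i = column i \<Theta>\<^sub>2" for i
    by (simp add: \<delta>_def column_def vec_eq_iff)
  have k_entry: "k y $ i $ j = cinner (a j y) (column i \<Theta>\<^sub>2)" if "0 < y" "y < L" for y i j
  proof -
    have "k y $ i $ j = (conj_transpose \<Theta>\<^sub>2 ** (E y ** \<Theta>\<^sub>1)) $ i $ j"
      using k_pos[of y] that unfolding L_def E_def by (simp add: matrix_mul_assoc)
    also have "\<dots> = (conj_transpose \<Theta>\<^sub>2 *v a j y) $ i"
      by (simp add: matrix_mult_nth matrix_vector_mult_def a_def column_def)
    finally show ?thesis by (simp only: conj_transpose_mult_nth)
  qed
  have kernel_eq: "D_difference_kernel d k s t = damped_kernel (\<lambda>i j. k 0 $ i $ j) s t"
    if s: "s \<in> {0<..<l}" and t: "t \<in> {0<..<l}" for s t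
  proof -
    have "k (d i * s - d j * t) $ i $ j = damped_kernel (\<lambda>i j. k 0 $ i $ j) s t $ i $ j" for i j
    proof -
      define y where "y = d i * s - d j * t"
      have y: "- L < y" "y < L"
        using dt_range[OF s, of i] dt_range[OF t, of j] by (auto simp: y_def)
      have "k y $ i $ j = cnj (cinner (a i (- y)) (column j \<Theta>\<^sub>2))" if "y < 0"
        using k_neg[of "- y"] k_entry[of "- y" j i] y that
        by (simp add: L_def conj_transpose_nth)
      moreover have "damped_kernel (\<lambda>i j. k 0 $ i $ j) s t $ i $ j =
          (if 0 < y then cinner (a j y) (column i \<Theta>\<^sub>2)
           else if y < 0 then cnj (cinner (a i (- y)) (column j \<Theta>\<^sub>2)) else k 0 $ i $ j)"
        unfolding damped_kernel_def y_def vec_lambda_beta Let_def column_2 ..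
      ultimately show ?thesis
        using k_entry[of y i j] y unfolding y_def[symmetric]
        by (cases y "0 :: real" rule: linorder_cases) simp_all
    qed
    then show ?thesis by (simp add: D_difference_kernel_def vec_eq_iff)
  qed
  have "S_operator l d k = second_kind_op l (D_difference_kernel d k)"
    by (simp add: fun_eq_iff S_operator_def second_kind_op_def)
  then show ?thesis using damped_operator_properties[OF kernel_eq] by simp
qed

end
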